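(* Let $\mathsf T=(T,\varepsilon,\delta)$ be a comonad on a triangulated category $\mathcal C$, and let $\mathcal C'\subset\mathcal C$ be a triangulated subcategory. Suppose that the functor $T$ is exact and that the category of comodules $\mathcal C_{\mathsf T}$ is triangulated in the sense specified in the context. Suppose that $T$ is upper triangular with respect to a semiorthogonal decomposition $\mathcal C=\langle\mathcal A_1,\ldots,\mathcal A_n\rangle$, that is, $T\mathcal A_k\subset\langle\mathcal A_1,\ldots,\mathcal A_k\rangle$ for all $1\le k\le n$. Suppose also that this decomposition induces a semiorthogonal decomposition $\mathcal C'=\langle\mathcal A'_1,\ldots,\mathcal A'_n\rangle$, where $\mathcal A'_k=\mathcal A_k\cap\mathcal C'$. Then the category $\mathcal C'_{\mathsf T}$ is triangulated and admits a semiorthogonal decomposition $\mathcal C'_{\mathsf T}=\langle\mathcal A'_{1\mathsf T},\ldots,\mathcal A'_{n\mathsf T}\rangle$.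
   Context: Triangulated subcategories are full (and closed under isomorphism), as usual. A semiorthogonal decomposition $\mathcal C=\langle\mathcal A_1,\ldots,\mathcal A_n\rangle$ consists of full triangulated subcategories with $\operatorname{Hom}(F_j,F_i)=0$ for $F_i\in\mathcal A_i$, $F_j\in\mathcal A_j$, $i<j$, that together generate $\mathcal C$ as a triangulated category; $\langle\mathcal A_1,\ldots,\mathcal A_k\rangle$ is the triangulated subcategory generated by $\mathcal A_1,\dots,\mathcal A_k$. A comonad $\mathsf T=(T,\varepsilon,\delta)$ on a category $\mathcal C$ consists of a functor $T\colon\mathcal C\to\mathcal C$ and natural transformations $\varepsilon\colon T\to\mathrm{Id}_{\mathcal C}$, $\delta\colon T\to T^2$ such that $T\varepsilon\circ\delta=\mathrm{id}_T=\varepsilon T\circ\delta$ and $T\delta\circ\delta=\delta T\circ\delta$. A comodule over $\mathsf T$ is a pair $(F,h)$ with $F\in\mathcal C$ and $h\colon F\to TF$ a morphism such that $\varepsilon_F\circ h=\mathrm{id}_F$ and $Th\circ h=\delta_F\circ h$. A morphism $(F_1,h_1)\to(F_2,h_2)$ is a morphism $f\colon F_1\to F_2$ in $\mathcal C$ with $h_2\circ f=Tf\circ h_1$. Comodules form the category $\mathcal C_{\mathsf T}$. For a subcategory $\mathcal C'\subset\mathcal C$, $\mathcal C'_{\mathsf T}$ is the full subcategory of $\mathcal C_{\mathsf T}$ of comodules $(F,h)$ with $F\in\mathcal C'$ (no assumption that $T$ preserves $\mathcal C'$); similarly $\mathcal A'_{k\mathsf T}\subset\mathcal C_{\mathsf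 T}$ is the full subcategory of comodules $(F,h)$ with $F\in\mathcal A'_k$. Candidate triangulated structure on $\mathcal C_{\mathsf T}$: the shift is $(F,h)[1]=(F[1],h[1])$, $f[1]=f[1]$, and a triangle $(F',h')\to(F,h)\to(F'',h'')\to(F',h')[1]$ in $\mathcal C_{\mathsf T}$ is distinguished if $F'\to F\to F''\to F'[1]$ is distinguished in $\mathcal C$. "$\mathcal C_{\mathsf T}$ is triangulated in the sense specified" means that these data are well defined and make $\mathcal C_{\mathsf T}$ a triangulated category; $\mathcal C'_{\mathsf T}$ is triangulated by the same structure. *)

theory Defs
  imports "HOL-Algebra.Group" HOL.Hull
begin

text \<open>
  A category is given by its objects, its hom-sets, identities and composition; the triangulated
  structure adds addition and zero of morphisms, the shift functor and the distinguished triangles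
  \<open>X \<rightarrow> Y \<rightarrow> Z \<rightarrow> X[1]\<close>. The operations on morphisms are single functions that are only
  constrained on the hom-sets. The hom-sets are not required to be disjoint, so that a morphism of
  comodules can be its underlying morphism; an arbitrary category takes this form once its
  morphisms are tagged with source and target.
\<close>

record ('o, 'm, 'p, 'q) fun_data =
  ob_map :: "'o \<Rightarrow> 'p"
  mor_map :: "'m \<Rightarrow> 'q"

record ('o, 'm) cat_data =
  Obj :: "'o set"
  Mor :: "'o \<Rightarrow> 'o \<Rightarrow> 'm set"
  Ident :: "'o \<Rightarrow> 'm"
  Comp :: "'m \<Rightarrow> 'm \<Rightarrow> 'm" (infixl "\<cdot>\<index>" 70)

record ('o, 'm) tri_data = "('o, 'm) cat_data" +
  Add :: "'m \<Rightarrow> 'm \<Rightarrow> 'm"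
  Zero :: "'o \<Rightarrow> 'o \<Rightarrow> 'm"
  Shift :: "('o, 'm, 'o, 'm) fun_data"
  Dist :: "'o \<Rightarrow> 'o \<Rightarrow> 'o \<Rightarrow> 'm \<Rightarrow> 'm \<Rightarrow> 'm \<Rightarrow> bool"


section \<open>Categories and functors\<close>

locale category =
  fixes C :: "('o, 'm, 'z) cat_data_scheme" (structure)
  assumes ident_mor: "X \<in> Obj C \<Longrightarrow> Ident C X \<in> Mor C X X"
    and comp_mor: "\<lbrakk>X \<in> Obj C; Y \<in> Obj C; Z \<in> Obj C; f \<in> Mor C X Y; g \<in> Mor C Y Z\<rbrakk>
      \<Longrightarrow> g \<cdot> f \<in> Mor C X Z"
    and comp_ident: "\<lbrakk>X \<in> Obj C; Y \<in> Obj C; f \<in> Mor C X Y\<rbrakk> \<Longrightarrow> f \<cdot> Ident C X = f"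
    and ident_comp: "\<lbrakk>X \<in> Obj C; Y \<in> Obj C; f \<in> Mor C X Y\<rbrakk> \<Longrightarrow> Ident C Y \<cdot> f = f"
    and comp_assoc: "\<lbrakk>X \<in> Obj C; Y \<in> Obj C; Z \<in> Obj C; W \<in> Obj C;
        f \<in> Mor C X Y; g \<in> Mor C Y Z; h \<in> Mor C Z W\<rbrakk>
      \<Longrightarrow> (h \<cdot> g) \<cdot> f = h \<cdot> (g \<cdot> f)"

definition inverse_mors :: "('o, 'm, 'z) cat_data_scheme \<Rightarrow> 'o \<Rightarrow> 'o \<Rightarrow> 'm \<Rightarrow> 'm \<Rightarrow> bool" where
  "inverse_mors C X Y f g \<longleftrightarrow> f \<in> Mor C X Y \<and> g \<in> Mor C Y X
     \<and> g \<cdot>\<^bsub>C\<^esub> f = Ident C X \<and> f \<cdot>\<^bsub>C\<^esub> g = Ident C Y"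

definition isomorphism :: "('o, 'm, 'z) cat_data_scheme \<Rightarrow> 'o \<Rightarrow> 'o \<Rightarrow> 'm \<Rightarrow> bool" where
  "isomorphism C X Y f \<longleftrightarrow> (\<exists>g. inverse_mors C X Y f g)"

definition inverse_mor :: "('o, 'm, 'z) cat_data_scheme \<Rightarrow> 'o \<Rightarrow> 'o \<Rightarrow> 'm \<Rightarrow> 'm" where
  "inverse_mor C X Y f = (THE g. inverse_mors C X Y f g)"

definition isomorphic_objs :: "('o, 'm, 'z) cat_data_scheme \<Rightarrow> 'o \<Rightarrow> 'o \<Rightarrow> bool" where
  "isomorphic_objs C X Y \<longleftrightarrow> (\<exists>f. isomorphism C X Y f)"

definition zero_object :: "('o, 'm, 'z) cat_data_scheme \<Rightarrow> 'o \<Rightarrow> bool" where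
  "zero_object C N \<longleftrightarrow> N \<in> Obj C
     \<and> (\<forall>X\<in>Obj C. (\<exists>!f. f \<in> Mor C N X) \<and> (\<exists>!f. f \<in> Mor C X N))"

definition cat_functor ::
  "('o, 'm, 'y) cat_data_scheme \<Rightarrow> ('p, 'q, 'z) cat_data_scheme \<Rightarrow> ('o, 'm, 'p, 'q) fun_data \<Rightarrow> bool"
where
  "cat_functor C D F \<longleftrightarrow>
     (\<forall>X\<in>Obj C. ob_map F X \<in> Obj D)
     \<and> (\<forall>X\<in>Obj C. \<forall>Y\<in>Obj C. \<forall>f\<in>Mor C X Y. mor_map F f \<in> Mor D (ob_map F X) (ob_map F Y))
     \<and> (\<forall>X\<in>Obj C. mor_map F (Ident C X) = Ident D (ob_map F X))
     \<and> (\<forall>X\<in>Obj C. \<forall>Y\<in>Obj C. \<forall>Z\<in>Obj C. \<forall>f\<in>Mor C X Y. \<forall>g\<in>Mor C Y Z.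
          mor_map F (g \<cdot>\<^bsub>C\<^esub> f) = mor_map F g \<cdot>\<^bsub>D\<^esub> mor_map F f)"

definition id_fun :: "('o, 'm, 'o, 'm) fun_data" where
  "id_fun = \<lparr>ob_map = id, mor_map = id\<rparr>"

definition comp_fun ::
  "('p, 'q, 'r, 's) fun_data \<Rightarrow> ('o, 'm, 'p, 'q) fun_data \<Rightarrow> ('o, 'm, 'r, 's) fun_data" where
  "comp_fun G F = \<lparr>ob_map = ob_map G \<circ> ob_map F, mor_map = mor_map G \<circ> mor_map F\<rparr>"

definition natural_transformation ::
  "('o, 'm, 'y) cat_data_scheme \<Rightarrow> ('p, 'q, 'z) cat_data_scheme
   \<Rightarrow> ('o, 'm, 'p, 'q) fun_data \<Rightarrow> ('o, 'm, 'p, 'q) fun_data \<Rightarrow> ('o \<Rightarrow> 'q) \<Rightarrow> bool" where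
  "natural_transformation C D F G \<eta> \<longleftrightarrow>
     (\<forall>X\<in>Obj C. \<eta> X \<in> Mor D (ob_map F X) (ob_map G X))
     \<and> (\<forall>X\<in>Obj C. \<forall>Y\<in>Obj C. \<forall>f\<in>Mor C X Y.
          \<eta> Y \<cdot>\<^bsub>D\<^esub> mor_map F f = mor_map G f \<cdot>\<^bsub>D\<^esub> \<eta> X)"

definition natural_isomorphism ::
  "('o, 'm, 'y) cat_data_scheme \<Rightarrow> ('p, 'q, 'z) cat_data_scheme
   \<Rightarrow> ('o, 'm, 'p, 'q) fun_data \<Rightarrow> ('o, 'm, 'p, 'q) fun_data \<Rightarrow> ('o \<Rightarrow> 'q) \<Rightarrow> bool" where
  "natural_isomorphism C D F G \<eta> \<longleftrightarrow> natural_transformation C D F G \<eta>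
     \<and> (\<forall>X\<in>Obj C. isomorphism D (ob_map F X) (ob_map G X) (\<eta> X))"

definition equivalence_functor ::
  "('o, 'm, 'y) cat_data_scheme \<Rightarrow> ('p, 'q, 'z) cat_data_scheme \<Rightarrow> ('o, 'm, 'p, 'q) fun_data \<Rightarrow> bool"
where
  "equivalence_functor C D F \<longleftrightarrow> cat_functor C D F
     \<and> (\<forall>X\<in>Obj C. \<forall>Y\<in>Obj C.
          bij_betw (mor_map F) (Mor C X Y) (Mor D (ob_map F X) (ob_map F Y)))
     \<and> (\<forall>Y\<in>Obj D. \<exists>X\<in>Obj C. isomorphic_objs D (ob_map F X) Y)"


section \<open>Additive categories\<close>

definition hom_group :: "('o, 'm, 'z) tri_data_scheme \<Rightarrow> 'o \<Rightarrow> 'o \<Rightarrow> 'm monoid" where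
  "hom_group C X Y = \<lparr>carrier = Mor C X Y, monoid.mult = Add C, one = Zero C X Y\<rparr>"

definition Neg :: "('o, 'm, 'z) tri_data_scheme \<Rightarrow> 'o \<Rightarrow> 'o \<Rightarrow> 'm \<Rightarrow> 'm" where
  "Neg C X Y f = inv\<^bsub>hom_group C X Y\<^esub> f"

locale additive_category = category C
  for C :: "('o, 'm, 'z) tri_data_scheme" (structure) +
  assumes hom_comm_group: "\<lbrakk>X \<in> Obj C; Y \<in> Obj C\<rbrakk> \<Longrightarrow> comm_group (hom_group C X Y)"
    and comp_add: "\<lbrakk>X \<in> Obj C; Y \<in> Obj C; Z \<in> Obj C;
        f \<in> Mor C X Y; f' \<in> Mor C X Y; g \<in> Mor C Y Z\<rbrakk>
      \<Longrightarrow> g \<cdot> Add C f f' = Add C (g \<cdot> f) (g \<cdot> f')"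
    and add_comp: "\<lbrakk>X \<in> Obj C; Y \<in> Obj C; Z \<in> Obj C;
        f \<in> Mor C X Y; g \<in> Mor C Y Z; g' \<in> Mor C Y Z\<rbrakk>
      \<Longrightarrow> Add C g g' \<cdot> f = Add C (g \<cdot> f) (g' \<cdot> f)"
    and ex_zero_object: "\<exists>N. zero_object C N"
    and ex_biproduct: "\<lbrakk>X \<in> Obj C; Y \<in> Obj C\<rbrakk> \<Longrightarrow>
      \<exists>P\<in>Obj C. \<exists>i\<in>Mor C X P. \<exists>j\<in>Mor C Y P. \<exists>p\<in>Mor C P X. \<exists>q\<in>Mor C P Y.
        p \<cdot> i = Ident C X \<and> q \<cdot> j = Ident C Y
        \<and> p \<cdot> j = Zero C Y X \<and> q \<cdot> i = Zero C X Y
        \<and> Add C (i \<cdot> p) (j \<cdot> q) = Ident C P"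

definition additive_functor ::
  "('o, 'm, 'y) tri_data_scheme \<Rightarrow> ('p, 'q, 'z) tri_data_scheme \<Rightarrow> ('o, 'm, 'p, 'q) fun_data \<Rightarrow> bool"
where
  "additive_functor C D F \<longleftrightarrow> cat_functor C D F
     \<and> (\<forall>X\<in>Obj C. \<forall>Y\<in>Obj C. \<forall>f\<in>Mor C X Y. \<forall>f'\<in>Mor C X Y.
          mor_map F (Add C f f') = Add D (mor_map F f) (mor_map F f'))"


section \<open>Triangulated categories\<close>

text \<open>
  These are Verdier's axioms, with a shift that is an additive autoequivalence (not necessarily an
  automorphism).
\<close>

abbreviation sh_ob :: "('o, 'm, 'z) tri_data_scheme \<Rightarrow> 'o \<Rightarrow> 'o" where
  "sh_ob C \<equiv> ob_map (Shift C)"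

abbreviation sh_mor :: "('o, 'm, 'z) tri_data_scheme \<Rightarrow> 'm \<Rightarrow> 'm" where
  "sh_mor C \<equiv> mor_map (Shift C)"

locale triangulated_category = additive_category C
  for C :: "('o, 'm, 'z) tri_data_scheme" (structure) +
  assumes shift_equivalence: "equivalence_functor C C (Shift C)"
    and shift_additive: "additive_functor C C (Shift C)"
    and dist_triangle: "Dist C X Y Z u v w \<Longrightarrow>
      X \<in> Obj C \<and> Y \<in> Obj C \<and> Z \<in> Obj C
      \<and> u \<in> Mor C X Y \<and> v \<in> Mor C Y Z \<and> w \<in> Mor C Z (sh_ob C X)"
    and dist_iso: "\<lbrakk>Dist C X Y Z u v w; X' \<in> Obj C; Y' \<in> Obj C; Z' \<in> Obj C;
        u' \<in> Mor C X' Y'; v' \<in> Mor C Y' Z'; w' \<in> Mor C Z' (sh_ob C X');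
        isomorphism C X X' a; isomorphism C Y Y' b; isomorphism C Z Z' c;
        b \<cdot> u = u' \<cdot> a; c \<cdot> v = v' \<cdot> b; sh_mor C a \<cdot> w = w' \<cdot> c\<rbrakk>
      \<Longrightarrow> Dist C X' Y' Z' u' v' w'"
    and dist_ident: "\<lbrakk>X \<in> Obj C; zero_object C N\<rbrakk>
      \<Longrightarrow> Dist C X X N (Ident C X) (Zero C X N) (Zero C N (sh_ob C X))"
    and dist_complete: "\<lbrakk>X \<in> Obj C; Y \<in> Obj C; u \<in> Mor C X Y\<rbrakk>
      \<Longrightarrow> \<exists>Z v w. Dist C X Y Z u v w"
    and dist_rotate: "\<lbrakk>X \<in> Obj C; Y \<in> Obj C; Z \<in> Obj C;
        u \<in> Mor C X Y; v \<in> Mor C Y Z; w \<in> Mor C Z (sh_ob C X)\<rbrakk>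
      \<Longrightarrow> Dist C X Y Z u v w
        \<longleftrightarrow> Dist C Y Z (sh_ob C X) v w (Neg C (sh_ob C X) (sh_ob C Y) (sh_mor C u))"
    and dist_morphism: "\<lbrakk>Dist C X Y Z u v w; Dist C X' Y' Z' u' v' w';
        a \<in> Mor C X X'; b \<in> Mor C Y Y'; b \<cdot> u = u' \<cdot> a\<rbrakk>
      \<Longrightarrow> \<exists>c\<in>Mor C Z Z'. c \<cdot> v = v' \<cdot> b \<and> sh_mor C a \<cdot> w = w' \<cdot> c"
    and dist_octahedron: "\<lbrakk>Dist C X Y Z' u j k; Dist C Y Z X' v l i; Dist C X Z Y' (v \<cdot> u) m n\<rbrakk>
      \<Longrightarrow> \<exists>f\<in>Mor C Z' Y'. \<exists>g\<in>Mor C Y' X'.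
        Dist C Z' Y' X' f g (sh_mor C j \<cdot> i)
        \<and> f \<cdot> j = m \<cdot> v \<and> n \<cdot> f = k \<and> g \<cdot> m = l \<and> sh_mor C u \<cdot> n = i \<cdot> g"

text \<open>
  An exact functor comes with its isomorphism \<open>\<phi> : F \<circ> [1] \<rightarrow> [1] \<circ> F\<close>.
\<close>

definition exact_functor ::
  "('o, 'm, 'y) tri_data_scheme \<Rightarrow> ('p, 'q, 'z) tri_data_scheme
   \<Rightarrow> ('o, 'm, 'p, 'q) fun_data \<Rightarrow> ('o \<Rightarrow> 'q) \<Rightarrow> bool" where
  "exact_functor C D F \<phi> \<longleftrightarrow> additive_functor C D F
     \<and> natural_isomorphism C D (comp_fun F (Shift C)) (comp_fun (Shift D) F) \<phi>
     \<and> (\<forall>X Y Z u v w. Dist C X Y Z u v w \<longrightarrow>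
          Dist D (ob_map F X) (ob_map F Y) (ob_map F Z)
            (mor_map F u) (mor_map F v) (\<phi> X \<cdot>\<^bsub>D\<^esub> mor_map F w))"

text \<open>
  Full subcategories are represented by their sets of objects.
\<close>

definition full_subcategory ::
  "('o, 'm, 'z) tri_data_scheme \<Rightarrow> 'o set \<Rightarrow> ('o, 'm, 'z) tri_data_scheme" where
  "full_subcategory C S = C\<lparr>Obj := Obj C \<inter> S,
     Dist := (\<lambda>X Y Z u v w. X \<in> S \<and> Y \<in> S \<and> Z \<in> S \<and> Dist C X Y Z u v w)\<rparr>"

definition triangulated_subcategory :: "('o, 'm, 'z) tri_data_scheme \<Rightarrow> 'o set \<Rightarrow> bool" where
  "triangulated_subcategory C S \<longleftrightarrow> S \<subseteq> Obj C \<and> S \<noteq> {}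
     \<and> (\<forall>X\<in>S. \<forall>Y\<in>Obj C. isomorphic_objs C X Y \<longrightarrow> Y \<in> S)
     \<and> (\<forall>X\<in>Obj C. X \<in> S \<longleftrightarrow> sh_ob C X \<in> S)
     \<and> (\<forall>X Y Z u v w. Dist C X Y Z u v w \<longrightarrow> X \<in> S \<longrightarrow> Y \<in> S \<longrightarrow> Z \<in> S)"

definition tri_span :: "('o, 'm, 'z) tri_data_scheme \<Rightarrow> 'o set \<Rightarrow> 'o set" where
  "tri_span C S = (triangulated_subcategory C) hull S"

definition semiorthogonal_decomposition ::
  "('o, 'm, 'z) tri_data_scheme \<Rightarrow> nat \<Rightarrow> (nat \<Rightarrow> 'o set) \<Rightarrow> bool" where
  "semiorthogonal_decomposition C n A \<longleftrightarrow>
     (\<forall>k\<in>{1..n}. triangulated_subcategory C (A k))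
     \<and> (\<forall>i\<in>{1..n}. \<forall>j\<in>{1..n}. i < j \<longrightarrow>
          (\<forall>X\<in>A j. \<forall>Y\<in>A i. Mor C X Y = {Zero C X Y}))
     \<and> tri_span C (\<Union>k\<in>{1..n}. A k) = Obj C"

definition upper_triangular ::
  "('o, 'm, 'z) tri_data_scheme \<Rightarrow> nat \<Rightarrow> (nat \<Rightarrow> 'o set) \<Rightarrow> ('o, 'm, 'o, 'm) fun_data \<Rightarrow> bool" where
  "upper_triangular C n A T \<longleftrightarrow> (\<forall>k\<in>{1..n}. ob_map T ` A k \<subseteq> tri_span C (\<Union>i\<in>{1..k}. A i))"


section \<open>Comonads and comodules\<close>

locale comonad = category C
  for C :: "('o, 'm, 'z) cat_data_scheme" (structure) +
  fixes T :: "('o, 'm, 'o, 'm) fun_data" and \<epsilon> \<delta> :: "'o \<Rightarrow> 'm"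
  assumes T_functor: "cat_functor C C T"
    and counit: "natural_transformation C C T id_fun \<epsilon>"
    and comult: "natural_transformation C C T (comp_fun T T) \<delta>"
    and T_counit: "F \<in> Obj C \<Longrightarrow> mor_map T (\<epsilon> F) \<cdot> \<delta> F = Ident C (ob_map T F)"
    and counit_T: "F \<in> Obj C \<Longrightarrow> \<epsilon> (ob_map T F) \<cdot> \<delta> F = Ident C (ob_map T F)"
    and coassoc: "F \<in> Obj C \<Longrightarrow> mor_map T (\<delta> F) \<cdot> \<delta> F = \<delta> (ob_map T F) \<cdot> \<delta> F"

definition comodule ::
  "('o, 'm, 'z) cat_data_scheme \<Rightarrow> ('o, 'm, 'o, 'm) fun_data
   \<Rightarrow> ('o \<Rightarrow> 'm) \<Rightarrow> ('o \<Rightarrow> 'm) \<Rightarrow> 'o \<Rightarrow> 'm \<Rightarrow> bool" where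
  "comodule C T \<epsilon> \<delta> F h \<longleftrightarrow> F \<in> Obj C \<and> h \<in> Mor C F (ob_map T F)
     \<and> \<epsilon> F \<cdot>\<^bsub>C\<^esub> h = Ident C F
     \<and> mor_map T h \<cdot>\<^bsub>C\<^esub> h = \<delta> F \<cdot>\<^bsub>C\<^esub> h"

definition comodules_in ::
  "('o, 'm, 'z) cat_data_scheme \<Rightarrow> ('o, 'm, 'o, 'm) fun_data
   \<Rightarrow> ('o \<Rightarrow> 'm) \<Rightarrow> ('o \<Rightarrow> 'm) \<Rightarrow> 'o set \<Rightarrow> ('o \<times> 'm) set" where
  "comodules_in C T \<epsilon> \<delta> S = {(F, h). comodule C T \<epsilon> \<delta> F h \<and> F \<in> S}"

definition comodule_mor ::
  "('o, 'm, 'z) cat_data_scheme \<Rightarrow> ('o, 'm, 'o, 'm) fun_data \<Rightarrow> 'o \<times> 'm \<Rightarrow> 'o \<times> 'm \<Rightarrow> 'm set" where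
  "comodule_mor C T M N =
     {f \<in> Mor C (fst M) (fst N). snd N \<cdot>\<^bsub>C\<^esub> f = mor_map T f \<cdot>\<^bsub>C\<^esub> snd M}"

text \<open>
  The shift of \<open>(F, h)\<close> is \<open>(F[1], h[1])\<close>, where \<open>h[1] : F[1] \<rightarrow> (T F)[1]\<close> is regarded as a
  morphism to \<open>T (F[1])\<close> through the isomorphism \<open>\<phi>\<close> of the exact functor \<open>T\<close>. The sum and the
  zero of comodule morphisms are those of \<open>C\<close>. That all of these are comodules or comodule
  morphisms is not built in: it is part of the statement that \<open>comodule_category\<close> is
  a \<open>triangulated_category\<close>.
\<close>

definition comodule_shift ::
  "('o, 'm, 'z) tri_data_scheme \<Rightarrow> ('o, 'm, 'o, 'm) fun_data \<Rightarrow> ('o \<Rightarrow> 'm)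
   \<Rightarrow> ('o \<times> 'm, 'm, 'o \<times> 'm, 'm) fun_data" where
  "comodule_shift C T \<phi> = \<lparr>
     ob_map = (\<lambda>(F, h). (sh_ob C F,
       inverse_mor C (ob_map T (sh_ob C F)) (sh_ob C (ob_map T F)) (\<phi> F) \<cdot>\<^bsub>C\<^esub> sh_mor C h)),
     mor_map = sh_mor C\<rparr>"

definition comodule_category ::
  "('o, 'm, 'z) tri_data_scheme \<Rightarrow> ('o, 'm, 'o, 'm) fun_data
   \<Rightarrow> ('o \<Rightarrow> 'm) \<Rightarrow> ('o \<Rightarrow> 'm) \<Rightarrow> ('o \<Rightarrow> 'm) \<Rightarrow> ('o \<times> 'm, 'm) tri_data" where
  "comodule_category C T \<epsilon> \<delta> \<phi> = \<lparr>
     Obj = comodules_in C T \<epsilon> \<delta> (Obj C),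
     Mor = comodule_mor C T,
     Ident = (\<lambda>M. Ident C (fst M)),
     Comp = Comp C,
     Add = Add C,
     Zero = (\<lambda>M N. Zero C (fst M) (fst N)),
     Shift = comodule_shift C T \<phi>,
     Dist = (\<lambda>M' M M'' u v w.
       {M', M, M''} \<subseteq> comodules_in C T \<epsilon> \<delta> (Obj C)
       \<and> u \<in> comodule_mor C T M' M \<and> v \<in> comodule_mor C T M M''
       \<and> w \<in> comodule_mor C T M'' (ob_map (comodule_shift C T \<phi>) M')
       \<and> Dist C (fst M') (fst M) (fst M'') u v w)\<rparr>"

end

theory Submission
  imports Defs
begin

text \<open>
  For triangulated subcategories with \<open>Hom(Q, P) = 0\<close>, the objects \<open>F\<close> in a triangle
  \<open>X \<rightarrow> F \<rightarrow> G\<close> with \<open>X \<in> Q\<close>, \<open>G \<in> P\<close> form a triangulated subcategory, so the span of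
  \<open>A\<^sub>1, \<dots>, A\<^sub>k\<close> consists of iterated extensions. Given a comodule \<open>(F, h)\<close> with \<open>F\<close> in the span of
  \<open>A'\<^sub>1, \<dots>, A'\<^sub>k\<close>, take such a triangle with \<open>X \<in> A'\<^sub>k\<close>. As \<open>T\<close> is upper triangular,
  \<open>T G\<close> and \<open>T\<^sup>2 G\<close> are still right orthogonal to \<open>A\<^sub>k\<close>; hence \<open>h\<close> restricts uniquely
  to a coaction on \<open>X\<close>. The cone of \<open>X \<rightarrow> F\<close> in comodules has underlying object isomorphic to \<open>G\<close>,
  and induction on \<open>k\<close> shows that the comodules over \<open>A'\<^sub>1, \<dots>, A'\<^sub>n\<close> generate.
\<close>

section \<open>Additive categories\<close>

lemma isomorphic_objs_sym: "isomorphic_objs C X Y \<Longrightarrow> isomorphic_objs C Y X"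
  unfolding isomorphic_objs_def isomorphism_def inverse_mors_def by blast

lemma (in category) isomorphism_ident: "X \<in> Obj C \<Longrightarrow> isomorphism C X X (Ident C X)"
  unfolding isomorphism_def inverse_mors_def using ident_mor comp_ident by blast

text \<open>Stated for arbitrary sets of objects, so that it applies to single components, to terms
  of a filtration and to sets of comodules alike. In a decomposition the first argument is the one
  with the larger index.\<close>

definition orthogonal :: "('o, 'm, 'z) tri_data_scheme \<Rightarrow> 'o set \<Rightarrow> 'o set \<Rightarrow> bool" where
  "orthogonal C Q P \<longleftrightarrow> (\<forall>X\<in>Q. \<forall>Y\<in>P. Mor C X Y = {Zero C X Y})"

context additive_category
begin

section \<open>Hom-groups, zero morphisms and zero objects\<close>

lemma hom_group_group: "\<lbrakk>X \<in> Obj C; Y \<in> Obj C\<rbrakk> \<Longrightarrow> group (hom_group C X Y)"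
  using comm_group.axioms(2)[OF hom_comm_group] .

lemma zero_mor: "\<lbrakk>X \<in> Obj C; Y \<in> Obj C\<rbrakk> \<Longrightarrow> Zero C X Y \<in> Mor C X Y"
  using hom_group_group[THEN group.is_monoid, THEN monoid.one_closed]
  by (simp add: hom_group_def)

lemma add_mor:
  "\<lbrakk>X \<in> Obj C; Y \<in> Obj C; f \<in> Mor C X Y; g \<in> Mor C X Y\<rbrakk> \<Longrightarrow> Add C f g \<in> Mor C X Y"
  using hom_group_group[THEN group.is_monoid, THEN monoid.m_closed]
  by (simp add: hom_group_def)

lemma neg_mor: "\<lbrakk>X \<in> Obj C; Y \<in> Obj C; f \<in> Mor C X Y\<rbrakk> \<Longrightarrow> Neg C X Y f \<in> Mor C X Y"
  using hom_group_group[THEN group.inv_closed]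
  by (simp add: hom_group_def Neg_def)

lemma zero_add: "\<lbrakk>X \<in> Obj C; Y \<in> Obj C; f \<in> Mor C X Y\<rbrakk> \<Longrightarrow> Add C (Zero C X Y) f = f"
  using hom_group_group[THEN group.is_monoid, THEN monoid.l_one]
  by (simp add: hom_group_def)

lemma add_neg:
  "\<lbrakk>X \<in> Obj C; Y \<in> Obj C; f \<in> Mor C X Y\<rbrakk> \<Longrightarrow> Add C f (Neg C X Y f) = Zero C X Y"
  using hom_group_group[THEN group.r_inv]
  by (simp add: hom_group_def Neg_def)

lemma neg_neg:
  "\<lbrakk>X \<in> Obj C; Y \<in> Obj C; f \<in> Mor C X Y\<rbrakk> \<Longrightarrow> Neg C X Y (Neg C X Y f) = f"
  using hom_group_group[THEN group.inv_inv]
  by (simp add: hom_group_def Neg_def)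

lemma neg_unique:
  assumes "X \<in> Obj C" "Y \<in> Obj C" "f \<in> Mor C X Y" "g \<in> Mor C X Y" "Add C f g = Zero C X Y"
  shows "Neg C X Y f = g"
proof -
  interpret comm_group "hom_group C X Y" using hom_comm_group assms(1,2) .
  show ?thesis using assms inv_equality[of g f] m_comm[of f g] by (simp add: hom_group_def Neg_def)
qed

text \<open>A group has only one idempotent. This turns compatibility with sums, which is all that
  bilinearity of composition and \<open>additive_functor\<close> assert, into compatibility with
  zero morphisms.\<close>

lemma add_idem:
  "\<lbrakk>X \<in> Obj C; Y \<in> Obj C; f \<in> Mor C X Y; Add C f f = f\<rbrakk> \<Longrightarrow> f = Zero C X Y"
  using hom_group_group[THEN group.r_cancel_one, of X Y f f]
  by (simp add: hom_group_def)

lemma neg_zero: "\<lbrakk>X \<in> Obj C; Y \<in> Obj C\<rbrakk> \<Longrightarrow> Neg C X Y (Zero C X Y) = Zero C X Y"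
  by (simp add: neg_unique zero_add zero_mor)

lemma eqI_diff:
  assumes "X \<in> Obj C" "Y \<in> Obj C" "f \<in> Mor C X Y" "g \<in> Mor C X Y"
    and "Add C f (Neg C X Y g) = Zero C X Y"
  shows "f = g"
  using assms neg_unique[of X Y f "Neg C X Y g"] neg_mor neg_neg by metis

lemma comp_zero:
  assumes "X \<in> Obj C" "Y \<in> Obj C" "Z \<in> Obj C" "g \<in> Mor C Y Z"
  shows "g \<cdot> Zero C X Y = Zero C X Z"
proof -
  have z: "Zero C X Y \<in> Mor C X Y" using assms zero_mor by blast
  show ?thesis
    using add_idem[of X Z "g \<cdot> Zero C X Y"] comp_add[of X Y Z "Zero C X Y" "Zero C X Y" g]
      comp_mor[OF assms(1-3) z] zero_add[OF assms(1,2) z] assms z by simp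
qed

lemma zero_comp:
  assumes "X \<in> Obj C" "Y \<in> Obj C" "Z \<in> Obj C" "f \<in> Mor C X Y"
  shows "Zero C Y Z \<cdot> f = Zero C X Z"
proof -
  have z: "Zero C Y Z \<in> Mor C Y Z" using assms zero_mor by blast
  show ?thesis
    using add_idem[of X Z "Zero C Y Z \<cdot> f"] add_comp[of X Y Z f "Zero C Y Z" "Zero C Y Z"]
      comp_mor[OF assms(1-4) z] zero_add[OF assms(2,3) z] assms z by simp
qed

lemma comp_neg:
  assumes "X \<in> Obj C" "Y \<in> Obj C" "Z \<in> Obj C" "f \<in> Mor C X Y" "g \<in> Mor C Y Z"
  shows "g \<cdot> Neg C X Y f = Neg C X Z (g \<cdot> f)"
  using assms neg_unique[of X Z "g \<cdot> f" "g \<cdot> Neg C X Y f"] comp_add[of X Y Z f "Neg C X Y f" g]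
  by (simp add: comp_mor[of X Y Z] neg_mor add_neg comp_zero)

lemma neg_comp:
  assumes "X \<in> Obj C" "Y \<in> Obj C" "Z \<in> Obj C" "f \<in> Mor C X Y" "g \<in> Mor C Y Z"
  shows "Neg C Y Z g \<cdot> f = Neg C X Z (g \<cdot> f)"
  using assms neg_unique[of X Z "g \<cdot> f" "Neg C Y Z g \<cdot> f"] add_comp[of X Y Z f g "Neg C Y Z g"]
  by (simp add: comp_mor[of X Y Z] neg_mor add_neg zero_comp)

text \<open>Every morphism into or out of \<open>X\<close> factors through its identity. The
  criterion mentions no other object, so it transfers at once along additive functors, to full
  subcategories and to comodules.\<close>

lemma zero_object_iff: "zero_object C X \<longleftrightarrow> X \<in> Obj C \<and> Ident C X = Zero C X X"
proof
  assume X: "zero_object C X"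
  then have "X \<in> Obj C" by (simp add: zero_object_def)
  with X show "X \<in> Obj C \<and> Ident C X = Zero C X X"
    unfolding zero_object_def using ident_mor zero_mor by blast
next
  assume X: "X \<in> Obj C \<and> Ident C X = Zero C X X"
  show "zero_object C X"
    unfolding zero_object_def
  proof (intro conjI ballI)
    fix Y assume Y: "Y \<in> Obj C"
    have "f = Zero C X Y" if "f \<in> Mor C X Y" for f
      using that X Y comp_ident[of X Y f] comp_zero[of X X Y f] by simp
    then show "\<exists>!f. f \<in> Mor C X Y" using X Y zero_mor by blast
    have "f = Zero C Y X" if "f \<in> Mor C Y X" for f
      using that X Y ident_comp[of Y X f] zero_comp[of Y X X f] by simp
    then show "\<exists>!f. f \<in> Mor C Y X" using X Y zero_mor by blast
  qed (use X in simp)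
qed

lemma zero_object_from: "\<lbrakk>zero_object C N; X \<in> Obj C\<rbrakk> \<Longrightarrow> Mor C N X = {Zero C N X}"
  unfolding zero_object_def using zero_mor by blast

lemma zero_object_to: "\<lbrakk>zero_object C N; X \<in> Obj C\<rbrakk> \<Longrightarrow> Mor C X N = {Zero C X N}"
  unfolding zero_object_def using zero_mor by blast

lemma zero_object_transport:
  assumes X: "zero_object C X" and Y: "Y \<in> Obj C" and iso: "isomorphic_objs C X Y"
  shows "zero_object C Y"
proof -
  obtain f g where fg: "f \<in> Mor C X Y" "g \<in> Mor C Y X" "f \<cdot> g = Ident C Y"
    using iso unfolding isomorphic_objs_def isomorphism_def inverse_mors_def by blast
  have Xo: "X \<in> Obj C" using X by (simp add: zero_object_def)
  have "f = Zero C X Y" using fg(1) zero_object_from[OF X Y] by blast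
  then show ?thesis using zero_comp[OF Y Xo Y fg(2)] fg(3) Y by (simp add: zero_object_iff)
qed

end

lemma additive_functor_zero:
  assumes F: "additive_functor C D F" and C: "additive_category C" and D: "additive_category D"
    and X: "X \<in> Obj C" and Y: "Y \<in> Obj C"
  shows "mor_map F (Zero C X Y) = Zero D (ob_map F X) (ob_map F Y)"
proof -
  interpret C: additive_category C by fact
  interpret D: additive_category D by fact
  have z: "Zero C X Y \<in> Mor C X Y" using C.zero_mor X Y .
  have "ob_map F X \<in> Obj D" "ob_map F Y \<in> Obj D"
    "mor_map F (Zero C X Y) \<in> Mor D (ob_map F X) (ob_map F Y)"
    "Add D (mor_map F (Zero C X Y)) (mor_map F (Zero C X Y)) = mor_map F (Zero C X Y)"
    using F X Y z C.zero_add[OF X Y z] unfolding additive_functor_def cat_functor_def by metis+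
  then show ?thesis by (rule D.add_idem)
qed

lemma additive_functor_zero_object:
  assumes F: "additive_functor C D F" and C: "additive_category C" and D: "additive_category D"
    and N: "zero_object C N"
  shows "zero_object D (ob_map F N)"
proof -
  interpret C: additive_category C by fact
  interpret D: additive_category D by fact
  show ?thesis
    using F N additive_functor_zero[OF F C D, of N N]
    unfolding C.zero_object_iff D.zero_object_iff additive_functor_def cat_functor_def by metis
qed

section \<open>Triangulated categories\<close>

context triangulated_category
begin

section \<open>The shift as an additive autoequivalence\<close>

lemma sh_obj: "X \<in> Obj C \<Longrightarrow> sh_ob C X \<in> Obj C"
  using shift_equivalence by (simp add: equivalence_functor_def cat_functor_def)

lemma sh_mor_in:
  "\<lbrakk>X \<in> Obj C; Y \<in> Obj C; f \<in> Mor C X Y\<rbrakk> \<Longrightarrow> sh_mor C f \<in> Mor C (sh_ob C X) (sh_ob C Y)"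
  using shift_equivalence by (simp add: equivalence_functor_def cat_functor_def)

lemma sh_comp:
  "\<lbrakk>X \<in> Obj C; Y \<in> Obj C; Z \<in> Obj C; f \<in> Mor C X Y; g \<in> Mor C Y Z\<rbrakk>
    \<Longrightarrow> sh_mor C (g \<cdot> f) = sh_mor C g \<cdot> sh_mor C f"
  using shift_equivalence unfolding equivalence_functor_def cat_functor_def by blast

lemma sh_ident: "X \<in> Obj C \<Longrightarrow> sh_mor C (Ident C X) = Ident C (sh_ob C X)"
  using shift_equivalence unfolding equivalence_functor_def cat_functor_def by blast

lemma sh_zero:
  "\<lbrakk>X \<in> Obj C; Y \<in> Obj C\<rbrakk> \<Longrightarrow> sh_mor C (Zero C X Y) = Zero C (sh_ob C X) (sh_ob C Y)"
  using additive_functor_zero[OF shift_additive] additive_category_axioms by blast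

lemma sh_faithful:
  "\<lbrakk>X \<in> Obj C; Y \<in> Obj C; f \<in> Mor C X Y; g \<in> Mor C X Y; sh_mor C f = sh_mor C g\<rbrakk> \<Longrightarrow> f = g"
  using shift_equivalence unfolding equivalence_functor_def bij_betw_def inj_on_def by blast

lemma sh_full:
  assumes "X \<in> Obj C" "Y \<in> Obj C" "f \<in> Mor C (sh_ob C X) (sh_ob C Y)"
  obtains g where "g \<in> Mor C X Y" "f = sh_mor C g"
  using shift_equivalence assms unfolding equivalence_functor_def bij_betw_def by blast

text \<open>Rotation introduces the negative of a shifted morphism; the preimage is provided in this
  form so that \<open>dist_rotate\<close> can be read from right to left.\<close>

lemma sh_full_neg:
  assumes "X \<in> Obj C" "Y \<in> Obj C" "f \<in> Mor C (sh_ob C X) (sh_ob C Y)"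
  obtains g where "g \<in> Mor C X Y" "f = Neg C (sh_ob C X) (sh_ob C Y) (sh_mor C g)"
  using sh_full[OF assms(1,2) neg_mor[OF sh_obj sh_obj, OF assms]] neg_neg[OF sh_obj sh_obj, OF assms]
  by metis

lemma sh_ess_surj:
  assumes "Y \<in> Obj C"
  obtains X where "X \<in> Obj C" "isomorphic_objs C (sh_ob C X) Y"
  using shift_equivalence assms unfolding equivalence_functor_def by blast

lemma sh_zero_object: "X \<in> Obj C \<Longrightarrow> zero_object C (sh_ob C X) \<longleftrightarrow> zero_object C X"
  using sh_faithful[of X X "Ident C X" "Zero C X X"] sh_ident sh_zero sh_obj ident_mor zero_mor
  unfolding zero_object_iff by metis

section \<open>Rotation and exactness of Hom\<close>

lemma dist_rotate_right:
  "Dist C X Y Z u v w \<Longrightarrow> Dist C Y Z (sh_ob C X) v w (Neg C (sh_ob C X) (sh_ob C Y) (sh_mor C u))"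
  using dist_rotate dist_triangle by blast

text \<open>Three rotations. The signs they produce disappear in the existential quantifiers, since
  only the objects of the shifted triangle matter later.\<close>

lemma dist_shift:
  assumes "Dist C X Y Z u v w"
  shows "\<exists>u v w. Dist C (sh_ob C X) (sh_ob C Y) (sh_ob C Z) u v w"
  using assms by (meson dist_rotate_right)

text \<open>One rotation turns this into the identity triangle of \<open>X\<close>, with the zero
  object \<open>N[1]\<close> in the third place.\<close>

lemma dist_zero_ident:
  assumes X: "X \<in> Obj C" and N: "zero_object C N"
  shows "Dist C N X X (Zero C N X) (Ident C X) (Zero C X (sh_ob C N))"
proof -
  have No: "N \<in> Obj C" using N by (simp add: zero_object_def)
  have "Dist C X X (sh_ob C N) (Ident C X) (Zero C X (sh_ob C N)) (Zero C (sh_ob C N) (sh_ob C X))"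
    using dist_ident[OF X] N sh_zero_object[OF No] by blast
  then show ?thesis
    using dist_rotate[OF No X X zero_mor[OF No X] ident_mor[OF X] zero_mor[OF X sh_obj[OF No]]]
    by (simp add: sh_zero[OF No X] neg_zero sh_obj No X)
qed

text \<open>The identity of \<open>X\<close> and \<open>u\<close> map the triangle
  \<open>X \<rightarrow> X \<rightarrow> N\<close> to the given one, so the composite factors
  through the zero object \<open>N\<close>.\<close>

lemma dist_comp_zero:
  assumes d: "Dist C X Y Z u v w"
  shows "v \<cdot> u = Zero C X Z"
proof -
  obtain N where N: "zero_object C N" using ex_zero_object by blast
  then have No: "N \<in> Obj C" by (simp add: zero_object_def)
  note t = dist_triangle[OF d]
  obtain c where c: "c \<in> Mor C N Z" "c \<cdot> Zero C X N = v \<cdot> u"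
    using dist_morphism[OF dist_ident[of X, OF _ N] d, of "Ident C X" u] t ident_mor by auto
  then show ?thesis using comp_zero[of X N Z c] No t by simp
qed

text \<open>The rotated identity triangle of \<open>A\<close> maps to the rotated given triangle by
  \<open>f\<close> and a zero morphism. Since the shift is full and faithful, the third component
  \<open>A[1] \<rightarrow> X[1]\<close> is the shift of a lift of \<open>f\<close>; the signs from
  the two rotations cancel.\<close>

lemma hom_exact:
  assumes d: "Dist C X Y Z u v w" and A: "A \<in> Obj C" and f: "f \<in> Mor C A Y"
    and vf: "v \<cdot> f = Zero C A Z"
  obtains g where "g \<in> Mor C A X" "u \<cdot> g = f"
proof -
  obtain N where N: "zero_object C N" using ex_zero_object by blast
  then have No: "N \<in> Obj C" by (simp add: zero_object_def)
  note t = dist_triangle[OF d]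
  have X: "X \<in> Obj C" and Y: "Y \<in> Obj C" and Z: "Z \<in> Obj C" and u: "u \<in> Mor C X Y" using t by auto
  have "Zero C N Z \<cdot> Zero C A N = v \<cdot> f"
    using vf comp_zero[OF A No Z zero_mor[OF No Z]] by simp
  with dist_morphism[OF dist_rotate_right[OF dist_ident[OF A N]] dist_rotate_right[OF d] f
      zero_mor[OF No Z]]
  obtain c where c: "c \<in> Mor C (sh_ob C A) (sh_ob C X)"
    and eq: "sh_mor C f \<cdot> Neg C (sh_ob C A) (sh_ob C A) (sh_mor C (Ident C A))
        = Neg C (sh_ob C X) (sh_ob C Y) (sh_mor C u) \<cdot> c"
    by blast
  obtain g where g: "g \<in> Mor C A X" "c = sh_mor C g" using sh_full[OF A X c] .
  note s = sh_obj[OF A] sh_obj[OF X] sh_obj[OF Y]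
  have "Neg C (sh_ob C A) (sh_ob C Y) (sh_mor C f) = Neg C (sh_ob C A) (sh_ob C Y) (sh_mor C (u \<cdot> g))"
    using eq comp_neg[OF s(1) s(1) s(3) ident_mor[OF s(1)] sh_mor_in[OF A Y f]]
      neg_comp[OF s c sh_mor_in[OF X Y u]]
    by (simp add: sh_ident[OF A] comp_ident[OF s(1,3) sh_mor_in[OF A Y f]] sh_comp[OF A X Y g(1) u] g(2))
  then have "sh_mor C f = sh_mor C (u \<cdot> g)"
    using neg_neg[OF s(1,3)] sh_mor_in[OF A Y] f comp_mor[OF A X Y g(1) u] by metis
  then have "u \<cdot> g = f"
    using sh_faithful[OF A Y] f comp_mor[OF A X Y g(1) u] by metis
  with g(1) show ?thesis by (rule that)
qed

text \<open>A zero morphism and \<open>f\<close> map the given triangle to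
  \<open>N \<rightarrow> A \<rightarrow> A\<close>, whose second morphism is the identity; the third
  component is the factorization.\<close>

lemma hom_exact_contra:
  assumes d: "Dist C X Y Z u v w" and A: "A \<in> Obj C" and f: "f \<in> Mor C Y A"
    and fu: "f \<cdot> u = Zero C X A"
  obtains g where "g \<in> Mor C Z A" "g \<cdot> v = f"
proof -
  obtain N where N: "zero_object C N" using ex_zero_object by blast
  then have No: "N \<in> Obj C" by (simp add: zero_object_def)
  note t = dist_triangle[OF d]
  have X: "X \<in> Obj C" and Y: "Y \<in> Obj C" using t by auto
  have "f \<cdot> u = Zero C N A \<cdot> Zero C X N"
    using fu comp_zero[OF X No A zero_mor[OF No A]] by simp
  with dist_morphism[OF d dist_zero_ident[OF A N] zero_mor[OF X No] f]
  show ?thesis using that ident_comp[OF Y A f] by auto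
qed

lemma hom_middle_zero:
  assumes d: "Dist C X Y Z u v w" and A: "A \<in> Obj C"
    and "Mor C A X = {Zero C A X}" and "Mor C A Z = {Zero C A Z}"
  shows "Mor C A Y = {Zero C A Y}"
proof -
  note t = dist_triangle[OF d]
  have "f = Zero C A Y" if f: "f \<in> Mor C A Y" for f
  proof -
    have "v \<cdot> f = Zero C A Z" using comp_mor[of A Y Z f v] t A f assms(4) by blast
    then obtain g where "g \<in> Mor C A X" "u \<cdot> g = f" using hom_exact[OF d A f] by blast
    then show ?thesis using assms(3) comp_zero[of A X Y u] t A by simp
  qed
  then show ?thesis using zero_mor[of A Y] t A by blast
qed

text \<open>The difference of \<open>f\<close> and \<open>g\<close> is killed by \<open>u\<close>,
  so its shift factors through \<open>w\<close> by a morphism \<open>A[1] \<rightarrow> Z\<close>,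
  which \<open>o\<close> makes zero. The hypothesis is about \<open>A[1]\<close> instead of a
  negative shift of \<open>Z\<close>, because the shift is only an equivalence and has no strict
  inverse in general.\<close>

lemma hom_inj:
  assumes d: "Dist C X Y Z u v w" and A: "A \<in> Obj C"
    and o: "Mor C (sh_ob C A) Z = {Zero C (sh_ob C A) Z}"
    and f: "f \<in> Mor C A X" and g: "g \<in> Mor C A X" and eq: "u \<cdot> f = u \<cdot> g"
  shows "f = g"
proof -
  note t = dist_triangle[OF d]
  have X: "X \<in> Obj C" and Y: "Y \<in> Obj C" and Z: "Z \<in> Obj C" and u: "u \<in> Mor C X Y"
    and w: "w \<in> Mor C Z (sh_ob C X)" using t by auto
  define e where "e = Add C f (Neg C A X g)"
  have e: "e \<in> Mor C A X" unfolding e_def using A X f g add_mor neg_mor by blast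
  have ue: "u \<cdot> e = Zero C A Y"
    unfolding e_def using comp_add[OF A X Y f neg_mor[OF A X g] u] comp_neg[OF A X Y g u] eq
      add_neg[OF A Y comp_mor[OF A X Y g u]] by simp
  note s = sh_obj[OF A] sh_obj[OF X] sh_obj[OF Y]
  have "Neg C (sh_ob C X) (sh_ob C Y) (sh_mor C u) \<cdot> sh_mor C e = Zero C (sh_ob C A) (sh_ob C Y)"
    using neg_comp[OF s sh_mor_in[OF A X e] sh_mor_in[OF X Y u]] sh_comp[OF A X Y e u] ue
      sh_zero[OF A Y] neg_zero[OF s(1,3)] by simp
  then obtain k where k: "k \<in> Mor C (sh_ob C A) Z" "w \<cdot> k = sh_mor C e"
    using hom_exact[OF dist_rotate_right[OF dist_rotate_right[OF d]] s(1) sh_mor_in[OF A X e]]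
    by metis
  then have "sh_mor C e = sh_mor C (Zero C A X)"
    using o comp_zero[OF s(1) Z s(2) w] sh_zero[OF A X] by simp
  then have "e = Zero C A X" using sh_faithful[OF A X e zero_mor[OF A X]] by simp
  then show ?thesis unfolding e_def by (rule eqI_diff[OF A X f g])
qed

section \<open>Replacing the cone, rotating backwards, and split triangles\<close>

lemma dist_iso_third:
  assumes d: "Dist C X Y Z u v w" and Z': "Z' \<in> Obj C" and iso: "isomorphic_objs C Z Z'"
  obtains v' w' where "Dist C X Y Z' u v' w'"
proof -
  obtain a b where ab: "inverse_mors C Z Z' a b"
    using iso unfolding isomorphic_objs_def isomorphism_def by blast
  then have a: "a \<in> Mor C Z Z'" "b \<in> Mor C Z' Z" "b \<cdot> a = Ident C Z" "isomorphism C Z Z' a"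
    by (auto simp: inverse_mors_def isomorphism_def)
  note t = dist_triangle[OF d]
  have X: "X \<in> Obj C" and Y: "Y \<in> Obj C" and Z: "Z \<in> Obj C" and u: "u \<in> Mor C X Y"
    and v: "v \<in> Mor C Y Z" and w: "w \<in> Mor C Z (sh_ob C X)" using t by auto
  have "Dist C X Y Z' u (a \<cdot> v) (w \<cdot> b)"
  proof (rule dist_iso[OF d X Y Z' u _ _ isomorphism_ident[OF X] isomorphism_ident[OF Y] a(4)])
    show v': "a \<cdot> v \<in> Mor C Y Z'" using comp_mor[OF Y Z Z' v a(1)] .
    show "w \<cdot> b \<in> Mor C Z' (sh_ob C X)" using comp_mor[OF Z' Z sh_obj[OF X] a(2) w] .
    show "Ident C Y \<cdot> u = u \<cdot> Ident C X" using ident_comp comp_ident X Y u by simp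
    show "a \<cdot> v = (a \<cdot> v) \<cdot> Ident C Y" using comp_ident[OF Y Z' v'] by simp
    show "sh_mor C (Ident C X) \<cdot> w = (w \<cdot> b) \<cdot> a"
      using sh_ident[OF X] ident_comp[OF Z sh_obj[OF X] w]
        comp_assoc[OF Z Z' Z sh_obj[OF X] a(1,2) w] a(3) comp_ident[OF Z sh_obj[OF X] w] by simp
  qed
  then show ?thesis by (rule that)
qed

text \<open>The shift is only essentially surjective, so \<open>V\<close> is first replaced by an
  isomorphic \<open>X[1]\<close>; then the last morphism is the negative of a shift and one rotation
  can be undone. The morphism \<open>v\<close> stays the same.\<close>

lemma dist_rotate_left:
  assumes d: "Dist C Y Z V v w u"
  obtains X u' w' where "X \<in> Obj C" "isomorphic_objs C (sh_ob C X) V" "Dist C X Y Z u' v w'"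
proof -
  have V: "V \<in> Obj C" and Y: "Y \<in> Obj C" and Z: "Z \<in> Obj C" using dist_triangle[OF d] by auto
  obtain X where X: "X \<in> Obj C" "isomorphic_objs C (sh_ob C X) V" using sh_ess_surj[OF V] .
  obtain w' u'' where d': "Dist C Y Z (sh_ob C X) v w' u''"
    using dist_iso_third[OF d sh_obj[OF X(1)] isomorphic_objs_sym[OF X(2)]] .
  note t' = dist_triangle[OF d']
  obtain u' where u': "u' \<in> Mor C X Y" "u'' = Neg C (sh_ob C X) (sh_ob C Y) (sh_mor C u')"
    using sh_full_neg[of X Y u''] X(1) t' by metis
  then have "Dist C X Y Z u' v w'"
    using dist_rotate[OF X(1) Y Z u'(1)] d' t' by simp
  with X show ?thesis by (rule that)
qed

text \<open>Writing all three morphisms as negatives of shifts puts the triangle in the form that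
  results from three rotations.\<close>

lemma dist_unshift:
  assumes d: "Dist C (sh_ob C X) (sh_ob C Y) (sh_ob C Z) u v w"
    and X: "X \<in> Obj C" and Y: "Y \<in> Obj C" and Z: "Z \<in> Obj C"
  obtains u' v' w' where "Dist C X Y Z u' v' w'"
proof -
  note t = dist_triangle[OF d]
  obtain u' where u': "u' \<in> Mor C X Y" "u = Neg C (sh_ob C X) (sh_ob C Y) (sh_mor C u')"
    using sh_full_neg[OF X Y, of u] t by metis
  obtain v' where v': "v' \<in> Mor C Y Z" "v = Neg C (sh_ob C Y) (sh_ob C Z) (sh_mor C v')"
    using sh_full_neg[OF Y Z, of v] t by metis
  obtain w' where w': "w' \<in> Mor C Z (sh_ob C X)"
    "w = Neg C (sh_ob C Z) (sh_ob C (sh_ob C X)) (sh_mor C w')"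
    using sh_full_neg[OF Z sh_obj[OF X], of w] t by metis
  note s = sh_obj[OF X] sh_obj[OF Y] sh_obj[OF Z]
  have "Dist C X Y Z u' v' w'"
    unfolding dist_rotate[OF X Y Z u'(1) v'(1) w'(1)]
      dist_rotate[OF Y Z s(1) v'(1) w'(1) neg_mor[OF s(1,2) sh_mor_in[OF X Y u'(1)]]]
      dist_rotate[OF Z s(1,2) w'(1) neg_mor[OF s(1,2) sh_mor_in[OF X Y u'(1)]]
        neg_mor[OF s(2,3) sh_mor_in[OF Y Z v'(1)]]]
    using d u'(2) v'(2) w'(2) by simp
  then show ?thesis by (rule that)
qed

text \<open>The cone of the split inclusion \<open>i\<close> is compared with \<open>Y\<close>: the
  composite of \<open>j\<close> with the map to the cone is inverse to the morphism induced by
  \<open>q\<close>. This makes triangulated subcategories closed under biproducts, although their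
  definition speaks of cones only.\<close>

lemma dist_biproduct:
  assumes X: "X \<in> Obj C" and Y: "Y \<in> Obj C" and P: "P \<in> Obj C"
    and i: "i \<in> Mor C X P" and j: "j \<in> Mor C Y P" and p: "p \<in> Mor C P X" and q: "q \<in> Mor C P Y"
    and pi: "p \<cdot> i = Ident C X" and qj: "q \<cdot> j = Ident C Y" and qi: "q \<cdot> i = Zero C X Y"
    and sum: "Add C (i \<cdot> p) (j \<cdot> q) = Ident C P"
  shows "\<exists>v w. Dist C X P Y i v w"
proof -
  obtain Z v w where d: "Dist C X P Z i v w" using dist_complete[OF X P i] by blast
  have Z: "Z \<in> Obj C" and v: "v \<in> Mor C P Z" and w: "w \<in> Mor C Z (sh_ob C X)"
    using dist_triangle[OF d] by auto
  note sX = sh_obj[OF X] and sP = sh_obj[OF P]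
  note si = sh_mor_in[OF X P i] and sp = sh_mor_in[OF P X p]
  have "Neg C (sh_ob C X) (sh_ob C P) (sh_mor C i) \<cdot> w = Zero C Z (sh_ob C P)"
    using dist_comp_zero[OF dist_rotate_right[OF dist_rotate_right[OF d]]] .
  then have "sh_mor C i \<cdot> w = Zero C Z (sh_ob C P)"
    using neg_comp[OF Z sX sP w si] neg_neg[OF Z sP comp_mor[OF Z sX sP w si]] neg_zero[OF Z sP]
    by simp
  \<comment> \<open>\<open>p[1]\<close> is a left inverse of \<open>i[1]\<close>, and
    \<open>i[1]\<close> kills \<open>w\<close>.\<close>
  then have w0: "w = Zero C Z (sh_ob C X)"
    using comp_assoc[OF Z sX sP sX w si sp] sh_comp[OF X P X i p] pi sh_ident[OF X]
      ident_comp[OF Z sX w] comp_zero[OF Z sP sX sp] by simp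
  obtain c where c: "c \<in> Mor C Z Y" "c \<cdot> v = q" using hom_exact_contra[OF d Y q qi] .
  have vj: "v \<cdot> j \<in> Mor C Y Z" using comp_mor[OF Y P Z j v] .
  have cvj: "c \<cdot> (v \<cdot> j) = Ident C Y" using comp_assoc[OF Y P Z Y j v c(1)] c(2) qj by simp
  define e where "e = (v \<cdot> j) \<cdot> c"
  have e: "e \<in> Mor C Z Z" unfolding e_def using comp_mor[OF Z Y Z c(1) vj] .
  have ip: "i \<cdot> p \<in> Mor C P P" and jq: "j \<cdot> q \<in> Mor C P P"
    using comp_mor[OF P X P p i] comp_mor[OF P Y P q j] .
  have "v = v \<cdot> Add C (i \<cdot> p) (j \<cdot> q)" using comp_ident[OF P Z v] sum by simp
  also have "\<dots> = Add C (Zero C P Z) (v \<cdot> (j \<cdot> q))"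
    using comp_add[OF P P Z ip jq v] comp_assoc[OF P X P Z p i v] dist_comp_zero[OF d]
      zero_comp[OF P X Z p] by simp
  also have "\<dots> = v \<cdot> (j \<cdot> q)" using zero_add[OF P Z comp_mor[OF P P Z jq v]] .
  also have "\<dots> = e \<cdot> v"
    unfolding e_def using comp_assoc[OF P Z Y Z v c(1) vj] c(2) comp_assoc[OF P Y P Z q j v] by simp
  finally have ev: "e \<cdot> v = v" by simp
  \<comment> \<open>The difference of \<open>e\<close> and the identity vanishes on
    \<open>v\<close>, so it factors through \<open>w\<close>, which is zero.\<close>
  have "Add C e (Neg C Z Z (Ident C Z)) \<cdot> v = Zero C P Z"
    using add_comp[OF P Z Z v e neg_mor[OF Z Z ident_mor[OF Z]]] ev
      neg_comp[OF P Z Z v ident_mor[OF Z]] ident_comp[OF P Z v] add_neg[OF P Z v] by simp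
  then obtain k where k: "k \<in> Mor C (sh_ob C X) Z" "k \<cdot> w = Add C e (Neg C Z Z (Ident C Z))"
    using hom_exact_contra[OF dist_rotate_right[OF d] Z
        add_mor[OF Z Z e neg_mor[OF Z Z ident_mor[OF Z]]]] by blast
  then have "Add C e (Neg C Z Z (Ident C Z)) = Zero C Z Z"
    using w0 comp_zero[OF Z sX Z k(1)] by simp
  then have "e = Ident C Z" by (rule eqI_diff[OF Z Z e ident_mor[OF Z]])
  then have "inverse_mors C Z Y c (v \<cdot> j)"
    unfolding inverse_mors_def e_def using c(1) vj cvj by simp
  then have "isomorphic_objs C Z Y" unfolding isomorphic_objs_def isomorphism_def by blast
  then show ?thesis using dist_iso_third[OF d Y] by metis
qed

end

section \<open>Triangulated subcategories\<close>

lemma triangulated_subcategoryD: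
  assumes "triangulated_subcategory C S"
  shows "S \<subseteq> Obj C" and "S \<noteq> {}"
    and "\<lbrakk>X \<in> S; Y \<in> Obj C; isomorphic_objs C X Y\<rbrakk> \<Longrightarrow> Y \<in> S"
    and "X \<in> Obj C \<Longrightarrow> sh_ob C X \<in> S \<longleftrightarrow> X \<in> S"
    and "\<lbrakk>Dist C X Y Z u v w; X \<in> S; Y \<in> S\<rbrakk> \<Longrightarrow> Z \<in> S"
  using assms unfolding triangulated_subcategory_def by blast+

lemma triangulated_subcategoryI:
  assumes "S \<subseteq> Obj C" and "S \<noteq> {}"
    and "\<And>X Y. \<lbrakk>X \<in> S; Y \<in> Obj C; isomorphic_objs C X Y\<rbrakk> \<Longrightarrow> Y \<in> S"
    and "\<And>X. X \<in> Obj C \<Longrightarrow> sh_ob C X \<in> S \<longleftrightarrow> X \<in> S"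
    and "\<And>X Y Z u v w. \<lbrakk>Dist C X Y Z u v w; X \<in> S; Y \<in> S\<rbrakk> \<Longrightarrow> Z \<in> S"
  shows "triangulated_subcategory C S"
  using assms unfolding triangulated_subcategory_def by blast

context triangulated_category
begin

text \<open>Two rotations exhibit \<open>Y[1]\<close> as a cone of \<open>w\<close>, and membership
  can be tested after a shift.\<close>

lemma subcat_middle:
  assumes S: "triangulated_subcategory C S" and d: "Dist C X Y Z u v w" and "X \<in> S" "Z \<in> S"
  shows "Y \<in> S"
proof -
  have ob: "X \<in> Obj C" "Y \<in> Obj C" using dist_triangle[OF d] by auto
  have "sh_ob C Y \<in> S"
    using triangulated_subcategoryD(5)[OF S dist_rotate_right[OF dist_rotate_right[OF d]]] assms
      triangulated_subcategoryD(4)[OF S ob(1)] by blast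
  then show ?thesis using triangulated_subcategoryD(4)[OF S ob(2)] by blast
qed

lemma subcat_first:
  assumes S: "triangulated_subcategory C S" and d: "Dist C X Y Z u v w" and "Y \<in> S" "Z \<in> S"
  shows "X \<in> S"
proof -
  have ob: "X \<in> Obj C" using dist_triangle[OF d] by auto
  show ?thesis
    using triangulated_subcategoryD(5)[OF S dist_rotate_right[OF d]] assms
      triangulated_subcategoryD(4)[OF S ob] by blast
qed

lemma subcat_zero_object:
  assumes S: "triangulated_subcategory C S" and N: "zero_object C N"
  shows "N \<in> S"
proof -
  obtain X where X: "X \<in> S" using triangulated_subcategoryD(2)[OF S] by blast
  then have "X \<in> Obj C" using triangulated_subcategoryD(1)[OF S] by blast
  from triangulated_subcategoryD(5)[OF S dist_ident[OF this N] X X] show ?thesis .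
qed

lemma triangulated_subcategory_Obj: "triangulated_subcategory C (Obj C)"
proof (rule triangulated_subcategoryI)
  show "Obj C \<noteq> {}" using ex_zero_object unfolding zero_object_def by blast
  show "sh_ob C X \<in> Obj C \<longleftrightarrow> X \<in> Obj C" if "X \<in> Obj C" for X using sh_obj that by blast
  show "Z \<in> Obj C" if "Dist C X Y Z u v w" for X Y Z u v w using dist_triangle[OF that] by blast
qed auto

lemma triangulated_subcategory_Int:
  assumes S: "triangulated_subcategory C S" and S': "triangulated_subcategory C S'"
  shows "triangulated_subcategory C (S \<inter> S')"
proof -
  obtain N where "zero_object C N" using ex_zero_object by blast
  then have "N \<in> S \<inter> S'" using subcat_zero_object S S' by blast
  then have ne: "S \<inter> S' \<noteq> {}" by blast
  note SD = triangulated_subcategoryD[OF S] and SD' = triangulated_subcategoryD[OF S']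
  show ?thesis
  proof (rule triangulated_subcategoryI[OF _ ne])
    show "S \<inter> S' \<subseteq> Obj C" using SD(1) by blast
    show "Y \<in> S \<inter> S'" if "X \<in> S \<inter> S'" "Y \<in> Obj C" "isomorphic_objs C X Y" for X Y
      using SD(3)[OF _ that(2,3)] SD'(3)[OF _ that(2,3)] that(1) by blast
    show "sh_ob C X \<in> S \<inter> S' \<longleftrightarrow> X \<in> S \<inter> S'" if "X \<in> Obj C" for X
      using SD(4)[OF that] SD'(4)[OF that] by blast
    show "Z \<in> S \<inter> S'" if "Dist C X Y Z u v w" "X \<in> S \<inter> S'" "Y \<in> S \<inter> S'" for X Y Z u v w
      using SD(5)[OF that(1)] SD'(5)[OF that(1)] that(2,3) by blast
  qed
qed

end

section \<open>Full subcategories on triangulated subcategories\<close>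

lemma full_subcategory_simps [simp]:
  "Obj (full_subcategory C S) = Obj C \<inter> S" "Mor (full_subcategory C S) = Mor C"
  "Ident (full_subcategory C S) = Ident C" "Comp (full_subcategory C S) = Comp C"
  "Add (full_subcategory C S) = Add C" "Zero (full_subcategory C S) = Zero C"
  "Shift (full_subcategory C S) = Shift C"
  "Dist (full_subcategory C S) X Y Z u v w \<longleftrightarrow> X \<in> S \<and> Y \<in> S \<and> Z \<in> S \<and> Dist C X Y Z u v w"
  "hom_group (full_subcategory C S) = hom_group C" "Neg (full_subcategory C S) = Neg C"
  "isomorphism (full_subcategory C S) = isomorphism C"
  "isomorphic_objs (full_subcategory C S) = isomorphic_objs C"
  by (simp_all add: full_subcategory_def fun_eq_iff hom_group_def Neg_def
      isomorphism_def inverse_mors_def isomorphic_objs_def)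

text \<open>The axioms restrict once the objects they claim to exist can be found in
  \<open>S\<close>: zero objects and cones by closure, a biproduct because it is an extension of its
  summands, and a preimage under the shift because \<open>S\<close> is closed under isomorphism and
  reflects the shift.\<close>

lemma (in triangulated_category) triangulated_full_subcategory:
  assumes S: "triangulated_subcategory C S"
  shows "triangulated_category (full_subcategory C S)"
proof -
  let ?E = "full_subcategory C S"
  note SD = triangulated_subcategoryD[OF S]
  have cat: "category ?E"
    by unfold_locales (use ident_mor comp_mor comp_ident ident_comp comp_assoc in auto)
  obtain N where N: "zero_object C N" using ex_zero_object by blast
  then have NS: "N \<in> S" using subcat_zero_object[OF S] by blast
  have zN: "zero_object ?E N" using N NS unfolding zero_object_def by simp
  have add: "additive_category ?E"
  proof (intro additive_category.intro cat additive_category_axioms.intro)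
    fix X Y assume "X \<in> Obj ?E" "Y \<in> Obj ?E"
    then have XS: "X \<in> S" and YS: "Y \<in> S" and X: "X \<in> Obj C" and Y: "Y \<in> Obj C" by auto
    from hom_comm_group[OF X Y] show "comm_group (hom_group ?E X Y)" by simp
    obtain P i j p q where b: "P \<in> Obj C" "i \<in> Mor C X P" "j \<in> Mor C Y P" "p \<in> Mor C P X"
      "q \<in> Mor C P Y" "p \<cdot> i = Ident C X" "q \<cdot> j = Ident C Y" "p \<cdot> j = Zero C Y X"
      "q \<cdot> i = Zero C X Y" "Add C (i \<cdot> p) (j \<cdot> q) = Ident C P"
      using ex_biproduct[OF X Y] by blast
    then obtain v w where "Dist C X P Y i v w" using dist_biproduct[OF X Y, of P i j p q] by blast
    then have "P \<in> S" using subcat_middle[OF S] XS YS by blast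
    then show "\<exists>P\<in>Obj ?E. \<exists>i\<in>Mor ?E X P. \<exists>j\<in>Mor ?E Y P. \<exists>p\<in>Mor ?E P X. \<exists>q\<in>Mor ?E P Y.
        p \<cdot>\<^bsub>?E\<^esub> i = Ident ?E X \<and> q \<cdot>\<^bsub>?E\<^esub> j = Ident ?E Y
        \<and> p \<cdot>\<^bsub>?E\<^esub> j = Zero ?E Y X \<and> q \<cdot>\<^bsub>?E\<^esub> i = Zero ?E X Y
        \<and> Add ?E (i \<cdot>\<^bsub>?E\<^esub> p) (j \<cdot>\<^bsub>?E\<^esub> q) = Ident ?E P"
      using b by (intro bexI[of _ P] bexI[of _ i] bexI[of _ j] bexI[of _ p] bexI[of _ q]) simp_all
  qed (use comp_add add_comp zN in auto)
  interpret E: additive_category ?E by fact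
  have shift: "cat_functor ?E ?E (Shift ?E)"
    using shift_equivalence SD(4) unfolding equivalence_functor_def cat_functor_def by auto
  show ?thesis
  proof (intro triangulated_category.intro add triangulated_category_axioms.intro)
    have "\<exists>X\<in>Obj C \<inter> S. isomorphic_objs C (sh_ob C X) Y" if Y: "Y \<in> Obj C \<inter> S" for Y
    proof -
      obtain X where X: "X \<in> Obj C" "isomorphic_objs C (sh_ob C X) Y"
        using sh_ess_surj[of Y] Y by blast
      have "sh_ob C X \<in> S" using SD(3)[OF _ sh_obj[OF X(1)] isomorphic_objs_sym[OF X(2)]] Y by blast
      then show ?thesis using SD(4)[OF X(1)] X by blast
    qed
    then show "equivalence_functor ?E ?E (Shift ?E)"
      using shift shift_equivalence unfolding equivalence_functor_def by simp
    show "additive_functor ?E ?E (Shift ?E)"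
      using shift shift_additive unfolding additive_functor_def by auto
    fix X Y Z u v w X' Y' Z' u' v' w' a b c
    assume "Dist ?E X Y Z u v w" "X' \<in> Obj ?E" "Y' \<in> Obj ?E" "Z' \<in> Obj ?E"
      "u' \<in> Mor ?E X' Y'" "v' \<in> Mor ?E Y' Z'" "w' \<in> Mor ?E Z' (sh_ob ?E X')"
      "isomorphism ?E X X' a" "isomorphism ?E Y Y' b" "isomorphism ?E Z Z' c"
      "b \<cdot>\<^bsub>?E\<^esub> u = u' \<cdot>\<^bsub>?E\<^esub> a" "c \<cdot>\<^bsub>?E\<^esub> v = v' \<cdot>\<^bsub>?E\<^esub> b"
      "sh_mor ?E a \<cdot>\<^bsub>?E\<^esub> w = w' \<cdot>\<^bsub>?E\<^esub> c"
    then show "Dist ?E X' Y' Z' u' v' w'"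
      using dist_iso[of X Y Z u v w X' Y' Z' u' v' w' a b c] by simp
  next
    fix X N assume "X \<in> Obj ?E" "zero_object ?E N"
    then show "Dist ?E X X N (Ident ?E X) (Zero ?E X N) (Zero ?E N (sh_ob ?E X))"
      using dist_ident[of X N] unfolding E.zero_object_iff zero_object_iff by simp
  next
    fix X Y u assume "X \<in> Obj ?E" "Y \<in> Obj ?E" "u \<in> Mor ?E X Y"
    then show "\<exists>Z v w. Dist ?E X Y Z u v w"
      using dist_complete[of X Y u] SD(5)[of X Y _ u] by fastforce
  next
    fix X Y Z u v w
    assume "X \<in> Obj ?E" "Y \<in> Obj ?E" "Z \<in> Obj ?E"
      "u \<in> Mor ?E X Y" "v \<in> Mor ?E Y Z" "w \<in> Mor ?E Z (sh_ob ?E X)"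
    then show "Dist ?E X Y Z u v w
        \<longleftrightarrow> Dist ?E Y Z (sh_ob ?E X) v w (Neg ?E (sh_ob ?E X) (sh_ob ?E Y) (sh_mor ?E u))"
      using dist_rotate[of X Y Z u v w] SD(4)[of X] by simp
  next
    fix X Y Z u v w X' Y' Z' u' v' w' a b
    assume "Dist ?E X Y Z u v w" "Dist ?E X' Y' Z' u' v' w'"
      "a \<in> Mor ?E X X'" "b \<in> Mor ?E Y Y'" "b \<cdot>\<^bsub>?E\<^esub> u = u' \<cdot>\<^bsub>?E\<^esub> a"
    then show "\<exists>c\<in>Mor ?E Z Z'. c \<cdot>\<^bsub>?E\<^esub> v = v' \<cdot>\<^bsub>?E\<^esub> b \<and> sh_mor ?E a \<cdot>\<^bsub>?E\<^esub> w = w' \<cdot>\<^bsub>?E\<^esub> c"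
      using dist_morphism[of X Y Z u v w X' Y' Z' u' v' w' a b] by simp
  next
    fix X Y Z' u j k Z X' v l i Y' m n
    assume "Dist ?E X Y Z' u j k" "Dist ?E Y Z X' v l i" "Dist ?E X Z Y' (v \<cdot>\<^bsub>?E\<^esub> u) m n"
    then show "\<exists>f\<in>Mor ?E Z' Y'. \<exists>g\<in>Mor ?E Y' X'.
        Dist ?E Z' Y' X' f g (sh_mor ?E j \<cdot>\<^bsub>?E\<^esub> i)
        \<and> f \<cdot>\<^bsub>?E\<^esub> j = m \<cdot>\<^bsub>?E\<^esub> v \<and> n \<cdot>\<^bsub>?E\<^esub> f = k \<and> g \<cdot>\<^bsub>?E\<^esub> m = l
        \<and> sh_mor ?E u \<cdot>\<^bsub>?E\<^esub> n = i \<cdot>\<^bsub>?E\<^esub> g"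
      using dist_octahedron[of X Y Z' u j k Z X' v l i Y' m n] by simp
  qed (use dist_triangle in auto)
qed

text \<open>Anything isomorphic to an object of \<open>U\<close>, or a shift or cone built from such
  objects, already lies in \<open>S\<close>. Hence spans formed in the full subcategory can be
  tested in the ambient category.\<close>

lemma (in triangulated_category) triangulated_subcategory_full_iff:
  assumes S: "triangulated_subcategory C S"
  shows "triangulated_subcategory (full_subcategory C S) U \<longleftrightarrow> triangulated_subcategory C U \<and> U \<subseteq> S"
proof -
  note SD = triangulated_subcategoryD[OF S]
  show ?thesis
  proof
    assume U: "triangulated_subcategory (full_subcategory C S) U"
    note UD = triangulated_subcategoryD[OF U, simplified]
    have US: "U \<subseteq> S" using UD(1) by blast
    have "triangulated_subcategory C U"
    proof (rule triangulated_subcategoryI)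
      show "U \<subseteq> Obj C" using UD(1) by blast
      show "U \<noteq> {}" using UD(2) .
      show "Y \<in> U" if "X \<in> U" "Y \<in> Obj C" "isomorphic_objs C X Y" for X Y
        using UD(3)[OF that(1) _ that(3)] SD(3)[OF _ that(2,3)] US that by blast
      show "sh_ob C X \<in> U \<longleftrightarrow> X \<in> U" if "X \<in> Obj C" for X
        using UD(4) SD(4)[OF that] US that by blast
      show "Z \<in> U" if "Dist C X Y Z u v w" "X \<in> U" "Y \<in> U" for X Y Z u v w
        using UD(5) SD(5)[OF that(1)] US that by blast
    qed
    with US show "triangulated_subcategory C U \<and> U \<subseteq> S" by blast
  next
    assume U: "triangulated_subcategory C U \<and> U \<subseteq> S"
    note UD = triangulated_subcategoryD[OF conjunct1[OF U]]
    show "triangulated_subcategory (full_subcategory C S) U"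
    proof (rule triangulated_subcategoryI)
      show "U \<subseteq> Obj (full_subcategory C S)" using U UD(1) by simp
      show "U \<noteq> {}" using UD(2) .
      show "Y \<in> U" if "X \<in> U" "Y \<in> Obj (full_subcategory C S)"
        "isomorphic_objs (full_subcategory C S) X Y" for X Y
        using UD(3)[of X Y] that by simp
      show "sh_ob (full_subcategory C S) X \<in> U \<longleftrightarrow> X \<in> U" if "X \<in> Obj (full_subcategory C S)" for X
        using UD(4)[of X] that by simp
      show "Z \<in> U" if "Dist (full_subcategory C S) X Y Z u v w" "X \<in> U" "Y \<in> U" for X Y Z u v w
        using UD(5)[of X Y Z u v w] that by simp
    qed
  qed
qed

section \<open>Extensions and semiorthogonal sequences\<close>

text \<open>The usual operation \<open>Q * P\<close> on classes of objects: all extensions of an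
  object of \<open>P\<close> by an object of \<open>Q\<close>.\<close>

definition star :: "('o, 'm, 'z) tri_data_scheme \<Rightarrow> 'o set \<Rightarrow> 'o set \<Rightarrow> 'o set" where
  "star C Q P = {F. \<exists>X\<in>Q. \<exists>G\<in>P. \<exists>u v w. Dist C X F G u v w}"

lemma starI: "\<lbrakk>Dist C X F G u v w; X \<in> Q; G \<in> P\<rbrakk> \<Longrightarrow> F \<in> star C Q P"
  unfolding star_def by blast

lemma starE:
  assumes "F \<in> star C Q P"
  obtains X G u v w where "X \<in> Q" "G \<in> P" "Dist C X F G u v w"
  using assms unfolding star_def by blast

lemma star_mono: "\<lbrakk>Q \<subseteq> Q'; P \<subseteq> P'\<rbrakk> \<Longrightarrow> star C Q P \<subseteq> star C Q' P'"
  unfolding star_def by blast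

locale orthogonal_pair = triangulated_category C
  for C :: "('o, 'm, 'z) tri_data_scheme" (structure) +
  fixes Q P :: "'o set"
  assumes Q: "triangulated_subcategory C Q" and P: "triangulated_subcategory C P"
    and QP: "orthogonal C Q P"
begin

text \<open>
  For \<open>G \<rightarrow> H \<rightarrow> F\<close> and \<open>X \<rightarrow> F \<rightarrow> G'\<close>, the map \<open>X \<rightarrow> F \<rightarrow> G[1]\<close> vanishes by orthogonality, so
  \<open>X \<rightarrow> F\<close> lifts to \<open>H\<close>; the octahedron of \<open>X \<rightarrow> H \<rightarrow> F\<close> shows that the cone of the lift is in \<open>P\<close>.
\<close>

lemma star_extend_right:
  assumes d: "Dist C G H F u v w" and G: "G \<in> P" and F: "F \<in> star C Q P"
  shows "H \<in> star C Q P"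
proof -
  note PD = triangulated_subcategoryD[OF P]
  obtain X G' a b c where X: "X \<in> Q" and G': "G' \<in> P" and e: "Dist C X F G' a b c"
    using F by (rule starE)
  have ob: "G \<in> Obj C" "H \<in> Obj C" "F \<in> Obj C" "X \<in> Obj C"
    and w: "w \<in> Mor C F (sh_ob C G)" and a: "a \<in> Mor C X F"
    using dist_triangle[OF d] dist_triangle[OF e] by auto
  have "w \<cdot> a \<in> Mor C X (sh_ob C G)" using comp_mor[OF ob(4,3) sh_obj[OF ob(1)] a w] .
  then have wa: "w \<cdot> a = Zero C X (sh_ob C G)"
    using QP X G PD(4)[OF ob(1)] unfolding orthogonal_def by blast
  obtain a' where a': "a' \<in> Mor C X H" "v \<cdot> a' = a"
    using hom_exact[OF dist_rotate_right[OF d] ob(4) a wa] .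
  obtain K b' c' where K: "Dist C X H K a' b' c'" using dist_complete[OF ob(4,2) a'(1)] by blast
  have "Dist C X F G' (v \<cdot> a') b c" using e a'(2) by simp
  from dist_octahedron[OF K dist_rotate_right[OF d] this]
  obtain f g h where "Dist C K G' (sh_ob C G) f g h" by blast
  then have "K \<in> P" using subcat_first[OF P] G' G PD(4)[OF ob(1)] by blast
  with K X show ?thesis by (blast intro: starI)
qed

text \<open>The octahedron of \<open>F \<rightarrow> H \<rightarrow> K\<close> presents the cone
  \<open>Y\<close> of the composite as an extension of \<open>X'[1]\<close> by \<open>X[1]\<close>,
  so \<open>Y\<close> is in \<open>Q\<close>. Rotating back, a desuspension of \<open>Y\<close> is
  the part of \<open>F\<close> in \<open>Q\<close>.\<close>

lemma star_extend_left:
  assumes d: "Dist C X F H u v w" and X: "X \<in> Q" and H: "H \<in> star C Q P"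
  shows "F \<in> star C Q P"
proof -
  note QD = triangulated_subcategoryD[OF Q]
  obtain X' K a b c where X': "X' \<in> Q" and K: "K \<in> P" and e: "Dist C X' H K a b c"
    using H by (rule starE)
  have ob: "X \<in> Obj C" "F \<in> Obj C" "H \<in> Obj C" "X' \<in> Obj C" "K \<in> Obj C"
    and b: "b \<in> Mor C H K" and v: "v \<in> Mor C F H"
    using dist_triangle[OF d] dist_triangle[OF e] by auto
  obtain Y g h where Y: "Dist C F K Y (b \<cdot> v) g h"
    using dist_complete[OF ob(2,5) comp_mor[OF ob(2,3,5) v b]] by blast
  obtain p q r where o: "Dist C (sh_ob C X) Y (sh_ob C X') p q r"
    using dist_octahedron[OF dist_rotate_right[OF d] dist_rotate_right[OF e] Y] by blast
  then have YQ: "Y \<in> Q" using subcat_middle[OF Q] X X' QD(4) ob by blast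
  obtain L u' w' where L: "L \<in> Obj C" "isomorphic_objs C (sh_ob C L) Y" "Dist C L F K u' (b \<cdot> v) w'"
    using dist_rotate_left[OF Y] .
  have "L \<in> Q" using QD(3)[OF YQ sh_obj[OF L(1)] isomorphic_objs_sym[OF L(2)]] QD(4)[OF L(1)] by blast
  with L(3) K show ?thesis by (blast intro: starI)
qed

text \<open>Let \<open>H\<close> be the cone of \<open>X \<rightarrow> F1 \<rightarrow> F\<close>.
  By the octahedron \<open>H\<close> is an extension of \<open>F2\<close> by \<open>G\<close>, which
  \<open>star_extend_right\<close> handles; then \<open>F\<close> is an extension of
  \<open>H\<close> by \<open>X\<close>, which \<open>star_extend_left\<close> handles.\<close>

lemma star_extend:
  assumes d: "Dist C F1 F F2 u v w" and F1: "F1 \<in> star C Q P" and F2: "F2 \<in> star C Q P"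
  shows "F \<in> star C Q P"
proof -
  obtain X G a b c where X: "X \<in> Q" and G: "G \<in> P" and e: "Dist C X F1 G a b c"
    using F1 by (rule starE)
  have ob: "F1 \<in> Obj C" "F \<in> Obj C" "X \<in> Obj C"
    and u: "u \<in> Mor C F1 F" and a: "a \<in> Mor C X F1"
    using dist_triangle[OF d] dist_triangle[OF e] by auto
  obtain H g h where H: "Dist C X F H (u \<cdot> a) g h"
    using dist_complete[OF ob(3,2) comp_mor[OF ob(3,1,2) a u]] by blast
  obtain p q r where "Dist C G H F2 p q r" using dist_octahedron[OF e d H] by blast
  then have "H \<in> star C Q P" using star_extend_right G F2 by blast
  with H X show ?thesis using star_extend_left by blast
qed

lemma star_shift:
  assumes F: "F \<in> Obj C"
  shows "sh_ob C F \<in> star C Q P \<longleftrightarrow> F \<in> star C Q P"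
proof
  note PD = triangulated_subcategoryD[OF P] and QD = triangulated_subcategoryD[OF Q]
  show "sh_ob C F \<in> star C Q P" if FS: "F \<in> star C Q P"
  proof -
    obtain X G a b c where X: "X \<in> Q" and G: "G \<in> P" and e: "Dist C X F G a b c"
      using FS by (rule starE)
    have "X \<in> Obj C" "G \<in> Obj C" using dist_triangle[OF e] by auto
    then show ?thesis using dist_shift[OF e] X G PD(4) QD(4) starI by metis
  qed
  assume "sh_ob C F \<in> star C Q P"
  then obtain X G a b c where X: "X \<in> Q" and G: "G \<in> P" and e: "Dist C X (sh_ob C F) G a b c"
    by (rule starE)
  \<comment> \<open>To remove the shift from \<open>F\<close>, the triangle is brought to the form
    \<open>F[1] \<rightarrow> G'[1] \<rightarrow> X[1]\<close>, unshifted to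
    \<open>F \<rightarrow> G' \<rightarrow> X\<close>, and rotated back to
    \<open>L \<rightarrow> F \<rightarrow> G'\<close>.\<close>
  obtain G' where G': "G' \<in> Obj C" "isomorphic_objs C (sh_ob C G') G"
    using sh_ess_surj PD(1) G by blast
  have "G' \<in> P" using PD(3)[OF G sh_obj isomorphic_objs_sym] PD(4) G' by blast
  obtain b1 c1 where e1: "Dist C X (sh_ob C F) (sh_ob C G') a b1 c1"
    using dist_iso_third[OF e sh_obj[OF G'(1)] isomorphic_objs_sym[OF G'(2)]] .
  have F: "F \<in> Obj C" and X': "X \<in> Obj C" using assms QD(1) X by auto
  obtain p q r where e2: "Dist C F G' X p q r"
    using dist_unshift[OF dist_rotate_right[OF e1] F G'(1) X'] .
  obtain L q' r' where L: "L \<in> Obj C" "isomorphic_objs C (sh_ob C L) X" "Dist C L F G' q' p r'"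
    using dist_rotate_left[OF e2] .
  have "L \<in> Q" using QD(3)[OF X sh_obj isomorphic_objs_sym] QD(4) L(1,2) by blast
  with L(3) \<open>G' \<in> P\<close> show "F \<in> star C Q P" by (blast intro: starI)
qed

text \<open>\<open>dist_iso_third\<close> replaces the third object only, so the triangle is rotated
  until \<open>F\<close> stands there and then rotated back.\<close>

lemma star_isomorphic:
  assumes F: "F \<in> star C Q P" and F': "F' \<in> Obj C" and iso: "isomorphic_objs C F F'"
  shows "F' \<in> star C Q P"
proof -
  note PD = triangulated_subcategoryD[OF P]
  obtain X G a b c where X: "X \<in> Q" and G: "G \<in> P" and e: "Dist C X F G a b c"
    using F by (rule starE)
  obtain L u w where L: "L \<in> Obj C" "isomorphic_objs C (sh_ob C L) G" "Dist C L X F u a w"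
    using dist_rotate_left[OF e] .
  have "sh_ob C L \<in> P" using PD(3)[OF G sh_obj isomorphic_objs_sym] L(1,2) by blast
  moreover obtain a' w' where "Dist C L X F' u a' w'" using dist_iso_third[OF L(3) F' iso] .
  ultimately show ?thesis using X dist_rotate_right starI by metis
qed

lemma left_subset_star: "Q \<subseteq> star C Q P"
proof
  fix X assume X: "X \<in> Q"
  obtain N where N: "zero_object C N" using ex_zero_object by blast
  show "X \<in> star C Q P"
    using starI[OF dist_ident[of X N] X] X N subcat_zero_object[OF P N]
      triangulated_subcategoryD(1)[OF Q] by blast
qed

lemma right_subset_star: "P \<subseteq> star C Q P"
proof
  fix X assume X: "X \<in> P"
  obtain N where N: "zero_object C N" using ex_zero_object by blast
  show "X \<in> star C Q P"
    using starI[OF dist_zero_ident[of X N]] X N subcat_zero_object[OF Q N]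
      triangulated_subcategoryD(1)[OF P] by blast
qed

lemma triangulated_subcategory_star: "triangulated_subcategory C (star C Q P)"
proof (rule triangulated_subcategoryI)
  show "star C Q P \<subseteq> Obj C" unfolding star_def using dist_triangle by blast
  show "star C Q P \<noteq> {}" using left_subset_star triangulated_subcategoryD(2)[OF Q] by blast
  show "Z \<in> star C Q P"
    if d: "Dist C X Y Z u v w" and X: "X \<in> star C Q P" and Y: "Y \<in> star C Q P" for X Y Z u v w
  \<comment> \<open>The cone \<open>Z\<close> is an extension of \<open>X[1]\<close> by
    \<open>Y\<close>, so closure under cones reduces to closure under extensions and shifts.\<close>
  proof (rule star_extend[OF dist_rotate_right[OF d] Y])
    show "sh_ob C X \<in> star C Q P" using star_shift[of X] dist_triangle[OF d] X by blast
  qed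
qed (fact star_isomorphic star_shift)+

end

section \<open>Filtrations by semiorthogonal components\<close>

lemma (in triangulated_category) triangulated_subcategory_zero:
  "triangulated_subcategory C {N. zero_object C N}"
proof -
  have "zero_object C Z" if X: "zero_object C X" and Y: "zero_object C Y"
    and d: "Dist C X Y Z u v w" for X Y Z u v w
  proof -
    have ob: "X \<in> Obj C" "Z \<in> Obj C" "Y \<in> Obj C" using dist_triangle[OF d] by auto
    \<comment> \<open>In \<open>Y \<rightarrow> Z \<rightarrow> X[1]\<close> both outer objects are
      zero, so the identity of \<open>Z\<close> vanishes.\<close>
    have "Mor C Z Z = {Zero C Z Z}"
      using hom_middle_zero[OF dist_rotate_right[OF d] ob(2)] zero_object_to ob X Y sh_zero_object
      by blast
    then show ?thesis using ident_mor[OF ob(2)] ob(2) by (simp add: zero_object_iff)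
  qed
  note cone = this
  show ?thesis
  proof (rule triangulated_subcategoryI)
    show "{N. zero_object C N} \<subseteq> Obj C" by (auto simp: zero_object_def)
    show "{N. zero_object C N} \<noteq> {}" using ex_zero_object by simp
    show "Y \<in> {N. zero_object C N}"
      if "X \<in> {N. zero_object C N}" "Y \<in> Obj C" "isomorphic_objs C X Y" for X Y
      using zero_object_transport[of X Y] that by simp
    show "sh_ob C X \<in> {N. zero_object C N} \<longleftrightarrow> X \<in> {N. zero_object C N}" if "X \<in> Obj C" for X
      using sh_zero_object[OF that] by simp
    show "Z \<in> {N. zero_object C N}"
      if "Dist C X Y Z u v w" "X \<in> {N. zero_object C N}" "Y \<in> {N. zero_object C N}" for X Y Z u v w
      using cone[OF _ _ that(1)] that(2,3) by simp
  qed
qed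

text \<open>An explicit form of the span of \<open>A 1\<close>, ..., \<open>A k\<close> by iterated
  extensions. The newest component stands on the left of \<open>star\<close>, since Hom from it to
  the earlier ones vanishes. Components are numbered from 1; index 0 holds the zero objects.\<close>

primrec filt :: "('o, 'm, 'z) tri_data_scheme \<Rightarrow> (nat \<Rightarrow> 'o set) \<Rightarrow> nat \<Rightarrow> 'o set" where
  "filt C A 0 = {N. zero_object C N}"
| "filt C A (Suc k) = star C (A (Suc k)) (filt C A k)"

text \<open>A semiorthogonal decomposition without the condition that the components generate. It
  therefore also covers the intersections with \<open>C'\<close>, viewed in \<open>C\<close>, where
  they generate only \<open>C'\<close>.\<close>

locale semiorthogonal_sequence = triangulated_category C
  for C :: "('o, 'm, 'z) tri_data_scheme" (structure) +
  fixes n :: nat and A :: "nat \<Rightarrow> 'o set"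
  assumes subcat: "k \<in> {1..n} \<Longrightarrow> triangulated_subcategory C (A k)"
    and orth: "\<lbrakk>i \<in> {1..n}; j \<in> {1..n}; i < j\<rbrakk> \<Longrightarrow> orthogonal C (A j) (A i)"
begin

text \<open>For fixed \<open>X\<close>, the objects \<open>Y\<close> with
  \<open>Hom(X, Y) = 0\<close> include the zero objects and are closed under extensions.\<close>

lemma orthogonal_filt: "\<lbrakk>k < j; j \<le> n\<rbrakk> \<Longrightarrow> orthogonal C (A j) (filt C A k)"
proof (induction k)
  case 0
  then show ?case
    using zero_object_to triangulated_subcategoryD(1)[OF subcat[of j]]
    by (auto simp: orthogonal_def)
next
  case (Suc k)
  show ?case unfolding orthogonal_def
  proof (intro ballI)
    fix X Y assume X: "X \<in> A j" and "Y \<in> filt C A (Suc k)"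
    then obtain Y1 Y2 u v w where Y1: "Y1 \<in> A (Suc k)" and Y2: "Y2 \<in> filt C A k"
      and d: "Dist C Y1 Y Y2 u v w" by (auto elim: starE)
    have "X \<in> Obj C" using X triangulated_subcategoryD(1)[OF subcat[of j]] Suc.prems by auto
    moreover have "orthogonal C (A j) (A (Suc k))" "orthogonal C (A j) (filt C A k)"
      using orth[of "Suc k" j] Suc by auto
    ultimately show "Mor C X Y = {Zero C X Y}"
      using hom_middle_zero[OF d] X Y1 Y2 unfolding orthogonal_def by blast
  qed
qed

lemma filt_triangulated: "k \<le> n \<Longrightarrow> triangulated_subcategory C (filt C A k)"
proof (induction k)
  case 0
  then show ?case using triangulated_subcategory_zero by simp
next
  case (Suc k)
  then interpret orthogonal_pair C "A (Suc k)" "filt C A k"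
    using subcat[of "Suc k"] orthogonal_filt[of k "Suc k"] by unfold_locales auto
  show ?case using triangulated_subcategory_star by simp
qed

lemma orthogonal_pair_filt: "Suc k \<le> n \<Longrightarrow> orthogonal_pair C (A (Suc k)) (filt C A k)"
  using subcat[of "Suc k"] orthogonal_filt[of k "Suc k"] filt_triangulated[of k]
  by unfold_locales auto

lemma subset_filt: "\<lbrakk>1 \<le> i; i \<le> k; k \<le> n\<rbrakk> \<Longrightarrow> A i \<subseteq> filt C A k"
proof (induction k)
  case (Suc k)
  then interpret orthogonal_pair C "A (Suc k)" "filt C A k" using orthogonal_pair_filt by blast
  show ?case using Suc left_subset_star right_subset_star by (cases "i = Suc k") auto
qed auto

lemma tri_span_subset_filt:
  assumes "k \<le> n"
  shows "tri_span C (\<Union>i\<in>{1..k}. A i) \<subseteq> filt C A k"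
  unfolding tri_span_def
proof (rule hull_minimal)
  show "(\<Union>i\<in>{1..k}. A i) \<subseteq> filt C A k"
  proof (rule UN_least)
    fix i assume "i \<in> {1..k}"
    then show "A i \<subseteq> filt C A k" using subset_filt[of i k] assms by simp
  qed
  show "triangulated_subcategory C (filt C A k)" using filt_triangulated[OF assms] .
qed

lemma filt_subset_Suc: "Suc k \<le> n \<Longrightarrow> filt C A k \<subseteq> filt C A (Suc k)"
  using orthogonal_pair.right_subset_star[OF orthogonal_pair_filt] by simp

text \<open>Upper triangularity speaks of single components. Exactness spreads it over extensions,
  so \<open>T\<close>, and hence its iterates, preserve each term of the filtration.\<close>

lemma exact_functor_filt:
  assumes T: "exact_functor C C T \<phi>" and upper: "upper_triangular C n A T"
  shows "\<lbrakk>k \<le> n; F \<in> filt C A k\<rbrakk> \<Longrightarrow> ob_map T F \<in> filt C A k"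
proof (induction k arbitrary: F)
  case 0
  have "additive_functor C C T" using T by (simp add: exact_functor_def)
  then show ?case using additive_functor_zero_object additive_category_axioms 0 by fastforce
next
  case (Suc k)
  then obtain X G u v w where X: "X \<in> A (Suc k)" and G: "G \<in> filt C A k"
    and d: "Dist C X F G u v w" by (auto elim: starE)
  have "ob_map T X \<in> filt C A (Suc k)"
    using upper X Suc.prems(1) tri_span_subset_filt[of "Suc k"]
    unfolding upper_triangular_def by fastforce
  moreover have "ob_map T G \<in> filt C A (Suc k)"
    using Suc G filt_subset_Suc[of k] by auto
  ultimately show ?case
    using subcat_middle[OF filt_triangulated[OF Suc.prems(1)]] d T
    unfolding exact_functor_def by blast
qed

end

lemma filt_mono:
  assumes "\<And>i. \<lbrakk>1 \<le> i; i \<le> k\<rbrakk> \<Longrightarrow> A i \<subseteq> B i"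
  shows "filt C A k \<subseteq> filt C B k"
  using assms
proof (induction k)
  case (Suc k)
  have "A (Suc k) \<subseteq> B (Suc k)" using Suc.prems[of "Suc k"] by simp
  moreover have "filt C A k \<subseteq> filt C B k" by (rule Suc.IH) (use Suc.prems in simp)
  ultimately show ?case using star_mono by simp
qed simp

text \<open>The octahedron of the identity of \<open>X\<close> followed by \<open>u\<close> gives a
  triangle \<open>N \<rightarrow> G' \<rightarrow> G\<close> with \<open>N\<close> zero. This lets a
  cone formed among comodules be compared with one chosen in \<open>C\<close>.\<close>

lemma (in triangulated_category) cone_mem_subcat:
  assumes S: "triangulated_subcategory C S" and d: "Dist C X F G u v w" and d': "Dist C X F G' u v' w'"
    and G: "G \<in> S"
  shows "G' \<in> S"
proof -
  obtain N where N: "zero_object C N" using ex_zero_object by blast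
  have X: "X \<in> Obj C" and F: "F \<in> Obj C" and u: "u \<in> Mor C X F" using dist_triangle[OF d] by auto
  have "Dist C X F G' (u \<cdot> Ident C X) v' w'" using d' comp_ident[OF X F u] by simp
  from dist_octahedron[OF dist_ident[OF X N] d this]
  obtain f g h where "Dist C N G' G f g h" by blast
  then show ?thesis using subcat_middle[OF S] subcat_zero_object[OF S N] G by blast
qed

section \<open>Comodules\<close>

lemma comodule_category_simps [simp]:
  "Obj (comodule_category C T \<epsilon> \<delta> \<phi>) = comodules_in C T \<epsilon> \<delta> (Obj C)"
  "Mor (comodule_category C T \<epsilon> \<delta> \<phi>) = comodule_mor C T"
  "Ident (comodule_category C T \<epsilon> \<delta> \<phi>) = (\<lambda>M. Ident C (fst M))"
  "Comp (comodule_category C T \<epsilon> \<delta> \<phi>) = Comp C"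
  "Zero (comodule_category C T \<epsilon> \<delta> \<phi>) = (\<lambda>M N. Zero C (fst M) (fst N))"
  "Shift (comodule_category C T \<epsilon> \<delta> \<phi>) = comodule_shift C T \<phi>"
  by (simp_all add: comodule_category_def)

lemma comodule_category_dist:
  "Dist (comodule_category C T \<epsilon> \<delta> \<phi>) M' M M'' u v w \<Longrightarrow> Dist C (fst M') (fst M) (fst M'') u v w"
  by (simp add: comodule_category_def)

lemma comodules_in_iff:
  "M \<in> comodules_in C T \<epsilon> \<delta> S \<longleftrightarrow> comodule C T \<epsilon> \<delta> (fst M) (snd M) \<and> fst M \<in> S"
  by (auto simp: comodules_in_def)

lemma comodule_mor_subset: "comodule_mor C T M N \<subseteq> Mor C (fst M) (fst N)"
  by (auto simp: comodule_mor_def)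

lemma fst_comodule_shift: "fst (ob_map (comodule_shift C T \<phi>) M) = sh_ob C (fst M)"
  by (simp add: comodule_shift_def split: prod.split)

lemma comodule_isomorphic_objs:
  assumes "isomorphic_objs (comodule_category C T \<epsilon> \<delta> \<phi>) M N"
  shows "isomorphic_objs C (fst M) (fst N)"
proof -
  obtain f g where "inverse_mors (comodule_category C T \<epsilon> \<delta> \<phi>) M N f g"
    using assms unfolding isomorphic_objs_def isomorphism_def by blast
  then have "inverse_mors C (fst M) (fst N) f g"
    by (simp add: inverse_mors_def comodule_mor_def)
  then show ?thesis unfolding isomorphic_objs_def isomorphism_def by blast
qed

section \<open>Comodules over a triangulated subcategory\<close>

locale triangulated_comodules =
  triangulated_category C + comonad C T \<epsilon> \<delta> + D: triangulated_category "comodule_category C T \<epsilon> \<delta> \<phi>"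
  for C :: "('o, 'm, 'z) tri_data_scheme" (structure) and T \<epsilon> \<delta> \<phi> +
  assumes exact: "exact_functor C C T \<phi>"
begin

abbreviation D :: "('o \<times> 'm, 'm) tri_data" where
  "D \<equiv> comodule_category C T \<epsilon> \<delta> \<phi>"

abbreviation comodules :: "'o set \<Rightarrow> ('o \<times> 'm) set" where
  "comodules \<equiv> comodules_in C T \<epsilon> \<delta>"

lemma Obj_D_iff: "M \<in> Obj D \<longleftrightarrow> comodule C T \<epsilon> \<delta> (fst M) (snd M)"
  by (auto simp: comodules_in_iff comodule_def)

lemma comodules_iff: "M \<in> comodules S \<longleftrightarrow> M \<in> Obj D \<and> fst M \<in> S"
  unfolding Obj_D_iff comodules_in_iff ..

lemma comodules_subset_Obj: "comodules S \<subseteq> Obj D"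
  using comodules_iff by blast

lemma comodules_mono: "S \<subseteq> S' \<Longrightarrow> comodules S \<subseteq> comodules S'"
  by (auto simp: comodules_in_def)

lemma comodule_fst_Obj: "M \<in> Obj D \<Longrightarrow> fst M \<in> Obj C"
  by (auto simp: comodules_in_def)

text \<open>The identity and zero morphisms of a comodule are those of the underlying object, so the
  criterion \<open>zero_object_iff\<close> reads the same on both sides.\<close>

lemma comodule_zero_object: "zero_object D M \<longleftrightarrow> M \<in> Obj D \<and> zero_object C (fst M)"
  unfolding D.zero_object_iff zero_object_iff using comodule_fst_Obj[of M] by auto

text \<open>Forgetting the coaction commutes with shifts and preserves isomorphisms and triangles,
  so the objects lying over \<open>S\<close> inherit its closure properties.\<close>

lemma triangulated_subcategory_comodules:
  assumes S: "triangulated_subcategory C S"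
  shows "triangulated_subcategory D (comodules S)"
proof -
  note SD = triangulated_subcategoryD[OF S]
  obtain N where N: "zero_object D N" using D.ex_zero_object by blast
  show ?thesis
  proof (rule triangulated_subcategoryI)
    show "comodules S \<subseteq> Obj D" by (rule comodules_subset_Obj)
    \<comment> \<open>A zero comodule has a zero underlying object, so it lies over every
      triangulated subcategory.\<close>
    have "N \<in> comodules S"
      unfolding comodules_iff using N subcat_zero_object[OF S] comodule_zero_object by blast
    then show "comodules S \<noteq> {}" by blast
    show "N \<in> comodules S" if "M \<in> comodules S" "N \<in> Obj D" "isomorphic_objs D M N" for M N
      using SD(3)[OF _ comodule_fst_Obj[OF that(2)] comodule_isomorphic_objs[OF that(3)]] that(1,2)
      unfolding comodules_iff by blast
    show "sh_ob D M \<in> comodules S \<longleftrightarrow> M \<in> comodules S" if "M \<in> Obj D" for M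
    proof -
      have "fst (sh_ob D M) = sh_ob C (fst M)" by (simp add: fst_comodule_shift)
      then show ?thesis
        unfolding comodules_iff using that SD(4)[OF comodule_fst_Obj[OF that]] D.sh_obj[OF that]
        by metis
    qed
    show "M'' \<in> comodules S"
      if "Dist D M' M M'' u v w" "M' \<in> comodules S" "M \<in> comodules S" for M' M M'' u v w
      using that(2,3) SD(5)[OF comodule_category_dist[OF that(1)]] D.dist_triangle[OF that(1)]
      unfolding comodules_iff by blast
  qed
qed

lemma orthogonal_comodules:
  assumes "orthogonal C Q P"
  shows "orthogonal D (comodules Q) (comodules P)"
  unfolding orthogonal_def
proof (intro ballI)
  fix M N assume M: "M \<in> comodules Q" and N: "N \<in> comodules P"
  then have "Mor C (fst M) (fst N) = {Zero C (fst M) (fst N)}"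
    using assms unfolding orthogonal_def comodules_iff by blast
  then have "Mor D M N \<subseteq> {Zero D M N}" using comodule_mor_subset[of C T M N] by simp
  moreover have "Zero D M N \<in> Mor D M N"
    by (rule D.zero_mor) (use comodules_subset_Obj M N in blast)+
  ultimately show "Mor D M N = {Zero D M N}" by blast
qed

section \<open>Restricting coactions and generating comodules\<close>

lemma T_obj: "X \<in> Obj C \<Longrightarrow> ob_map T X \<in> Obj C"
  using T_functor by (simp add: cat_functor_def)

lemma T_mor:
  "\<lbrakk>X \<in> Obj C; Y \<in> Obj C; f \<in> Mor C X Y\<rbrakk> \<Longrightarrow> mor_map T f \<in> Mor C (ob_map T X) (ob_map T Y)"
  using T_functor by (simp add: cat_functor_def)

lemma T_comp:
  "\<lbrakk>X \<in> Obj C; Y \<in> Obj C; Z \<in> Obj C; f \<in> Mor C X Y; g \<in> Mor C Y Z\<rbrakk>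
    \<Longrightarrow> mor_map T (g \<cdot> f) = mor_map T g \<cdot> mor_map T f"
  using T_functor unfolding cat_functor_def by blast

lemma T_dist:
  "Dist C X Y Z u v w \<Longrightarrow>
    \<exists>w'. Dist C (ob_map T X) (ob_map T Y) (ob_map T Z) (mor_map T u) (mor_map T v) w'"
  using exact unfolding exact_functor_def by blast

lemma counit_mor: "X \<in> Obj C \<Longrightarrow> \<epsilon> X \<in> Mor C (ob_map T X) X"
  using counit by (simp add: natural_transformation_def id_fun_def)

lemma counit_nat:
  "\<lbrakk>X \<in> Obj C; Y \<in> Obj C; f \<in> Mor C X Y\<rbrakk> \<Longrightarrow> \<epsilon> Y \<cdot> mor_map T f = f \<cdot> \<epsilon> X"
  using counit by (simp add: natural_transformation_def id_fun_def)

lemma comult_mor: "X \<in> Obj C \<Longrightarrow> \<delta> X \<in> Mor C (ob_map T X) (ob_map T (ob_map T X))"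
  using comult by (simp add: natural_transformation_def comp_fun_def)

lemma comult_nat:
  "\<lbrakk>X \<in> Obj C; Y \<in> Obj C; f \<in> Mor C X Y\<rbrakk>
    \<Longrightarrow> \<delta> Y \<cdot> mor_map T f = mor_map T (mor_map T f) \<cdot> \<delta> X"
  using comult by (simp add: natural_transformation_def comp_fun_def)

text \<open>
  The coaction on \<open>F\<close> restricts to \<open>X\<close> because \<open>Hom(X, T G) = 0\<close>. The comodule axioms for the
  restriction hold because \<open>i\<close>, \<open>T i\<close> and \<open>T\<^sup>2 i\<close> are monic for maps out of \<open>X\<close>.
\<close>

lemma restrict_coaction:
  assumes d: "Dist C X F G i v w" and c: "comodule C T \<epsilon> \<delta> F h"
    and Q: "triangulated_subcategory C Q" and X: "X \<in> Q"
    and QP: "orthogonal C Q P" and TP: "ob_map T ` P \<subseteq> P" and G: "G \<in> P"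
  obtains k where "comodule C T \<epsilon> \<delta> X k" "i \<in> comodule_mor C T (X, k) (F, h)"
proof -
  have o: "X \<in> Obj C" "F \<in> Obj C" "G \<in> Obj C" and i: "i \<in> Mor C X F" and v: "v \<in> Mor C F G"
    using dist_triangle[OF d] by auto
  have TG: "ob_map T G \<in> P" "ob_map T (ob_map T G) \<in> P" using TP G by auto
  \<comment> \<open>\<open>hom_inj\<close> tests injectivity through orthogonality of the shifted
    object.\<close>
  have sX: "sh_ob C X \<in> Q" using triangulated_subcategoryD(4)[OF Q o(1)] X by blast
  note To = o[THEN T_obj] and TTo = o[THEN T_obj, THEN T_obj]
  have h: "h \<in> Mor C F (ob_map T F)" "\<epsilon> F \<cdot> h = Ident C F" "mor_map T h \<cdot> h = \<delta> F \<cdot> h"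
    using c by (simp_all add: comodule_def)
  have Ti: "mor_map T i \<in> Mor C (ob_map T X) (ob_map T F)" using T_mor[OF o(1,2) i] .
  have TTi: "mor_map T (mor_map T i) \<in> Mor C (ob_map T (ob_map T X)) (ob_map T (ob_map T F))"
    using T_mor[OF To(1,2) Ti] .
  obtain w1 where d1: "Dist C (ob_map T X) (ob_map T F) (ob_map T G) (mor_map T i) (mor_map T v) w1"
    using T_dist[OF d] by blast
  obtain w2 where d2: "Dist C (ob_map T (ob_map T X)) (ob_map T (ob_map T F)) (ob_map T (ob_map T G))
      (mor_map T (mor_map T i)) (mor_map T (mor_map T v)) w2"
    using T_dist[OF d1] by blast
  have hi: "h \<cdot> i \<in> Mor C X (ob_map T F)" using comp_mor[OF o(1,2) To(2) i h(1)] .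
  have "mor_map T v \<cdot> (h \<cdot> i) = Zero C X (ob_map T G)"
    using comp_mor[OF o(1) To(2,3) hi T_mor[OF o(2,3) v]] QP X TG(1) unfolding orthogonal_def by blast
  then obtain k where k: "k \<in> Mor C X (ob_map T X)" and ik: "mor_map T i \<cdot> k = h \<cdot> i"
    using hom_exact[OF d1 o(1) hi] by blast
  have eps: "\<epsilon> X \<cdot> k = Ident C X"
  proof (rule hom_inj[OF d o(1)])
    show "Mor C (sh_ob C X) G = {Zero C (sh_ob C X) G}"
      using QP sX G unfolding orthogonal_def by blast
    show "\<epsilon> X \<cdot> k \<in> Mor C X X" using comp_mor[OF o(1) To(1) o(1) k counit_mor[OF o(1)]] .
    show "Ident C X \<in> Mor C X X" using ident_mor[OF o(1)] .
    have "i \<cdot> (\<epsilon> X \<cdot> k) = (\<epsilon> F \<cdot> mor_map T i) \<cdot> k"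
      using comp_assoc[OF o(1) To(1) o(1,2) k counit_mor[OF o(1)] i] counit_nat[OF o(1,2) i] by simp
    also have "\<dots> = \<epsilon> F \<cdot> (h \<cdot> i)"
      using comp_assoc[OF o(1) To(1,2) o(2) k Ti counit_mor[OF o(2)]] ik by simp
    also have "\<dots> = i"
      using comp_assoc[OF o(1,2) To(2) o(2) i h(1) counit_mor[OF o(2)]] h(2) ident_comp[OF o(1,2) i]
      by simp
    finally show "i \<cdot> (\<epsilon> X \<cdot> k) = i \<cdot> Ident C X" using comp_ident[OF o(1,2) i] by simp
  qed
  have Tk: "mor_map T k \<in> Mor C (ob_map T X) (ob_map T (ob_map T X))" using T_mor[OF o(1) To(1) k] .
  have Th: "mor_map T h \<in> Mor C (ob_map T F) (ob_map T (ob_map T F))" using T_mor[OF o(2) To(2) h(1)] .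
  note dX = comult_mor[OF o(1)] and dF = comult_mor[OF o(2)]
  have coa: "mor_map T k \<cdot> k = \<delta> X \<cdot> k"
  proof (rule hom_inj[OF d2 o(1)])
    show "Mor C (sh_ob C X) (ob_map T (ob_map T G)) = {Zero C (sh_ob C X) (ob_map T (ob_map T G))}"
      using QP sX TG(2) unfolding orthogonal_def by blast
    show "mor_map T k \<cdot> k \<in> Mor C X (ob_map T (ob_map T X))"
      using comp_mor[OF o(1) To(1) TTo(1) k Tk] .
    show "\<delta> X \<cdot> k \<in> Mor C X (ob_map T (ob_map T X))" using comp_mor[OF o(1) To(1) TTo(1) k dX] .
    have "mor_map T (mor_map T i) \<cdot> (mor_map T k \<cdot> k) = mor_map T (mor_map T i \<cdot> k) \<cdot> k"
      using comp_assoc[OF o(1) To(1) TTo(1,2) k Tk TTi] T_comp[OF o(1) To(1,2) k Ti] by simp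
    also have "\<dots> = mor_map T h \<cdot> (mor_map T i \<cdot> k)"
      using ik T_comp[OF o(1,2) To(2) i h(1)] comp_assoc[OF o(1) To(1,2) TTo(2) k Ti Th] by simp
    also have "\<dots> = (\<delta> F \<cdot> h) \<cdot> i"
      using ik comp_assoc[OF o(1,2) To(2) TTo(2) i h(1) Th] h(3) by simp
    also have "\<dots> = (\<delta> F \<cdot> mor_map T i) \<cdot> k"
      using ik comp_assoc[OF o(1,2) To(2) TTo(2) i h(1) dF] comp_assoc[OF o(1) To(1,2) TTo(2) k Ti dF]
      by simp
    also have "\<dots> = mor_map T (mor_map T i) \<cdot> (\<delta> X \<cdot> k)"
      using comult_nat[OF o(1,2) i] comp_assoc[OF o(1) To(1) TTo(1,2) k dX TTi] by simp
    finally show "mor_map T (mor_map T i) \<cdot> (mor_map T k \<cdot> k) = mor_map T (mor_map T i) \<cdot> (\<delta> X \<cdot> k)" .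
  qed
  show ?thesis
  proof (rule that)
    show "comodule C T \<epsilon> \<delta> X k" unfolding comodule_def using o(1) k eps coa by blast
    show "i \<in> comodule_mor C T (X, k) (F, h)" unfolding comodule_mor_def using i ik by simp
  qed
qed

text \<open>Two sequences are used together: \<open>T\<close> preserves the filtration by
  \<open>A\<close>, not necessarily the one by \<open>B\<close>, while the pieces of a comodule must
  lie over \<open>B\<close>. The triangle is chosen in the filtration by \<open>B\<close>, and the
  coaction is restricted using orthogonality and stability for \<open>A\<close>.\<close>

lemma comodules_filt_subset:
  assumes A: "semiorthogonal_sequence C n A" and B: "semiorthogonal_sequence C n B"
    and BA: "\<And>k. k \<in> {1..n} \<Longrightarrow> B k \<subseteq> A k" and upper: "upper_triangular C n A T"
    and U: "triangulated_subcategory D U" and BU: "\<And>k. k \<in> {1..n} \<Longrightarrow> comodules (B k) \<subseteq> U"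
  shows "k \<le> n \<Longrightarrow> comodules (filt C B k) \<subseteq> U"
proof (induction k)
  case 0
  show ?case
  proof
    fix M assume "M \<in> comodules (filt C B 0)"
    then have "zero_object D M"
      using comodules_iff[of M "filt C B 0"] unfolding comodule_zero_object filt.simps(1) mem_Collect_eq
      by simp
    then show "M \<in> U" by (rule D.subcat_zero_object[OF U])
  qed
next
  case (Suc k)
  interpret A: semiorthogonal_sequence C n A by fact
  interpret B: semiorthogonal_sequence C n B by fact
  show ?case
  proof
    fix M assume M: "M \<in> comodules (filt C B (Suc k))"
    obtain F h where Fh: "M = (F, h)" by (cases M)
    have c: "comodule C T \<epsilon> \<delta> F h" and "F \<in> star C (B (Suc k)) (filt C B k)"
      using M unfolding Fh by (simp_all add: comodules_in_iff)
    then obtain X G i v w where X: "X \<in> B (Suc k)" and G: "G \<in> filt C B k" and d: "Dist C X F G i v w"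
      by (auto elim: starE)
    have k: "Suc k \<in> {1..n}" "Suc k \<le> n" "k \<le> n" using Suc.prems by auto
    have "filt C B k \<subseteq> filt C A k"
    proof (rule filt_mono)
      show "B i \<subseteq> A i" if "1 \<le> i" "i \<le> k" for i using BA[of i] that k(3) by simp
    qed
    then have GA: "G \<in> filt C A k" using G by blast
    have XA: "X \<in> A (Suc k)" using X BA k by blast
    have TA: "ob_map T ` filt C A k \<subseteq> filt C A k"
      using A.exact_functor_filt[OF exact upper k(3)] by blast
    obtain g where g: "comodule C T \<epsilon> \<delta> X g" "i \<in> comodule_mor C T (X, g) (F, h)"
      using restrict_coaction[OF d c A.subcat[OF k(1)] XA A.orthogonal_filt[OF lessI k(2)] TA GA] .
    have "(X, g) \<in> comodules (B (Suc k))" using X g(1) by (simp add: comodules_in_iff)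
    then have XU: "(X, g) \<in> U" using BU[OF k(1)] by blast
    have ob: "(X, g) \<in> Obj D" "(F, h) \<in> Obj D" using g(1) c
      by (simp_all add: Obj_D_iff del: comodule_category_simps)
    have "i \<in> Mor D (X, g) (F, h)" using g(2) by simp
    from D.dist_complete[OF ob this]
    obtain N v' w' where N: "Dist D (X, g) (F, h) N i v' w'" by blast
    have "Dist C X F (fst N) i v' w'" using comodule_category_dist[OF N] by simp
    \<comment> \<open>\<open>fst N\<close> and \<open>G\<close> are cones of the same morphism
      \<open>i\<close>. The coaction on the quotient comes with \<open>N\<close>, so none has to be
      constructed on \<open>G\<close>.\<close>
    then have "fst N \<in> filt C B k" using cone_mem_subcat[OF B.filt_triangulated[OF k(3)] d _ G] by blast
    then have "N \<in> comodules (filt C B k)"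
      using D.dist_triangle[OF N] unfolding comodules_iff[of N "filt C B k"] by blast
    then have "N \<in> U" using Suc.IH[OF k(3)] by blast
    then show "M \<in> U" using D.subcat_middle[OF U N XU] Fh by blast
  qed
qed

end

section \<open>The induced decomposition of the comodules over \<open>C'\<close>\<close>

lemma semiorthogonal_sequenceI:
  assumes "triangulated_category C" "semiorthogonal_decomposition C n A"
  shows "semiorthogonal_sequence C n A"
proof (intro semiorthogonal_sequence.intro semiorthogonal_sequence_axioms.intro assms(1))
  show "triangulated_subcategory C (A k)" if "k \<in> {1..n}" for k
    using assms(2) that unfolding semiorthogonal_decomposition_def by blast
  show "orthogonal C (A j) (A i)" if "i \<in> {1..n}" "j \<in> {1..n}" "i < j" for i j
    using assms(2) that unfolding semiorthogonal_decomposition_def orthogonal_def by blast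
qed

theorem theorem3p2:
  fixes C :: "('o, 'm) tri_data"
    and T :: "('o, 'm, 'o, 'm) fun_data"
    and \<epsilon> \<delta> \<phi> :: "'o \<Rightarrow> 'm"
    and C' :: "'o set"
    and n :: nat
    and A :: "nat \<Rightarrow> 'o set"
  assumes "triangulated_category C"
    and "comonad C T \<epsilon> \<delta>"
    and "triangulated_subcategory C C'"
    and "exact_functor C C T \<phi>"
    and "triangulated_category (comodule_category C T \<epsilon> \<delta> \<phi>)"
    and "semiorthogonal_decomposition C n A"
    and "upper_triangular C n A T"
    and "semiorthogonal_decomposition (full_subcategory C C') n (\<lambda>k. A k \<inter> C')"
  shows "triangulated_category
           (full_subcategory (comodule_category C T \<epsilon> \<delta> \<phi>) (comodules_in C T \<epsilon> \<delta> C'))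
         \<and> semiorthogonal_decomposition
           (full_subcategory (comodule_category C T \<epsilon> \<delta> \<phi>) (comodules_in C T \<epsilon> \<delta> C'))
           n (\<lambda>k. comodules_in C T \<epsilon> \<delta> (A k \<inter> C'))"
proof -
  interpret triangulated_comodules C T \<epsilon> \<delta> \<phi>
    using assms by (intro triangulated_comodules.intro triangulated_comodules_axioms.intro)
  interpret A: semiorthogonal_sequence C n A using semiorthogonal_sequenceI assms(1,6) .
  define B where "B k = A k \<inter> C'" for k
  define E where "E = full_subcategory D (comodules C')"
  have C': "triangulated_subcategory C C'" using assms(3) .
  have DC': "triangulated_subcategory D (comodules C')" using triangulated_subcategory_comodules[OF C'] .
  interpret E: triangulated_category E
    unfolding E_def using D.triangulated_full_subcategory[OF DC'] .
  interpret B: semiorthogonal_sequence C n B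
  proof unfold_locales
    show "triangulated_subcategory C (B k)" if "k \<in> {1..n}" for k
      unfolding B_def using triangulated_subcategory_Int[OF A.subcat[OF that] C'] .
    show "orthogonal C (B j) (B i)" if "i \<in> {1..n}" "j \<in> {1..n}" "i < j" for i j
      using A.orth[OF that] unfolding B_def orthogonal_def by blast
  qed
  have BC': "comodules (B k) \<subseteq> comodules C'" for k
    unfolding B_def by (rule comodules_mono) blast
  have subcat: "triangulated_subcategory E (comodules (B k))" if "k \<in> {1..n}" for k
    unfolding E_def
    using D.triangulated_subcategory_full_iff[OF DC'] triangulated_subcategory_comodules B.subcat that BC'
    by blast
  have orth: "Mor E X Y = {Zero E X Y}"
    if "i \<in> {1..n}" "j \<in> {1..n}" "i < j" "X \<in> comodules (B j)" "Y \<in> comodules (B i)" for i j X Y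
    using orthogonal_comodules[OF B.orth[OF that(1-3)]] that(4,5)
    unfolding E_def orthogonal_def by simp
  \<comment> \<open>The hypothesis on \<open>C'\<close> concerns the span formed inside
    \<open>C'\<close>, so the filtration is cut down to \<open>C'\<close> to be a competitor there;
    minimality then puts \<open>C'\<close> inside \<open>filt C B n\<close>.\<close>
  have "triangulated_subcategory C (filt C B n \<inter> C')"
    using triangulated_subcategory_Int[OF B.filt_triangulated C'] by blast
  then have "triangulated_subcategory (full_subcategory C C') (filt C B n \<inter> C')"
    using triangulated_subcategory_full_iff[OF C'] by blast
  moreover have "(\<Union>k\<in>{1..n}. B k) \<subseteq> filt C B n \<inter> C'"
  proof (rule UN_least)
    fix k assume "k \<in> {1..n}"
    then show "B k \<subseteq> filt C B n \<inter> C'" using B.subset_filt[of k n] unfolding B_def by simp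
  qed
  ultimately have "tri_span (full_subcategory C C') (\<Union>k\<in>{1..n}. B k) \<subseteq> filt C B n \<inter> C'"
    unfolding tri_span_def by (intro hull_minimal)
  then have C'_filt: "C' \<subseteq> filt C B n"
    using assms(8) triangulated_subcategoryD(1)[OF C']
    unfolding semiorthogonal_decomposition_def B_def full_subcategory_simps by blast
  have "comodules C' \<subseteq> U"
    if U: "triangulated_subcategory E U" "(\<Union>k\<in>{1..n}. comodules (B k)) \<subseteq> U" for U
  proof -
    \<comment> \<open>Viewed in \<open>D\<close>, a competitor \<open>U\<close> for the span is
      still triangulated, so the induction over the filtration applies even though its intermediate
      comodules are formed in \<open>D\<close>.\<close>
    have DU: "triangulated_subcategory D U"
      using U(1) D.triangulated_subcategory_full_iff[OF DC'] unfolding E_def by blast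
    have "comodules (filt C B n) \<subseteq> U"
    proof (rule comodules_filt_subset[OF A.semiorthogonal_sequence_axioms
          B.semiorthogonal_sequence_axioms _ assms(7) DU])
      show "B k \<subseteq> A k" for k unfolding B_def by blast
      show "comodules (B k) \<subseteq> U" if "k \<in> {1..n}" for k using U(2) that by blast
    qed simp
    with comodules_mono[OF C'_filt] show ?thesis by blast
  qed
  moreover have Obj_E: "Obj E = comodules C'"
    unfolding E_def using comodules_subset_Obj by auto
  ultimately have "tri_span E (\<Union>k\<in>{1..n}. comodules (B k)) = Obj E"
    unfolding tri_span_def using E.triangulated_subcategory_Obj BC'
    by (intro hull_unique) blast+
  then have "semiorthogonal_decomposition E n (\<lambda>k. comodules (B k))"
    unfolding semiorthogonal_decomposition_def using subcat orth by blast
  then show ?thesis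
    using E.triangulated_category_axioms unfolding E_def B_def by blast
qed

end
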